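(* Let $d\in\mathbb{N}$, $\Omega=\Omega_1\times\cdots\times\Omega_d\subseteq\mathbb{R}^d$ with $\mu(\Omega)<\infty$, and let $\vec p=(p_1,\dots,p_d)$ with $0<p_i\le\infty$ for all $i$ and $\min\{p_1,\dots,p_d\}<\infty$. Then the growth envelope of the mixed Lebesgue space $L_{\vec p}(\Omega)$ is $$\mathfrak{E}_{\mathsf G}(L_{\vec p}(\Omega))=\left(t^{-1/\min\{p_1,\dots,p_d\}},\ \min\{p_1,\dots,p_d\}\right).$$
   Context: Setting: $\Omega_1,\dots,\Omega_d\subseteq\mathbb{R}$ are Lebesgue measurable sets of positive measure, $\Omega=\prod_i\Omega_i$, and $\mu$ is Lebesgue measure on $\Omega$. Mixed Lebesgue space: $L_{\vec p}(\Omega)$ consists of the measurable $f:\Omega\to\mathbb{R}$ with finite quasi-norm $$\|f\|_{\vec p}=\left(\int_{\Omega_d}\cdots\left(\int_{\Omega_1}|f(x_1,\dots,x_d)|^{p_1}\,dx_1\right)^{p_2/p_1}\cdots\,dx_d\right)^{1/p_d},$$ i.e. one takes the $L_{p_1}$ quasi-norm in $x_1$, then the $L_{p_2}$ quasi-norm in $x_2$, etc., with the essential supremum in $x_j$ if $p_j=\infty$. Rearrangement: $\mu_f(s)=\mu(\{|f|>s\})$ and $f^*(t)=\inf\{s>0:\mu_f(s)\le t\}$ for $t\ge0$ (with $\inf\emptyset=\infty$). Growth envelope: for a quasi-normed function space $X$ on $\Omega$, $\mathcal{E}_{\mathsf G}^X(t)=\sup\{f^*(t):\|f\|_X\le1\}$,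 $t>0$. Growth envelope functions are considered up to equivalence near $0$. For a positive, decreasing, continuously differentiable function $\Psi$ and $u\in(0,\infty]$, the equality $\mathfrak{E}_{\mathsf G}(X)=(\Psi(t),u)$ means: (i) there are $\varepsilon>0$ and constants $A,B>0$ with $A\,\Psi(t)\le\mathcal{E}_{\mathsf G}^X(t)\le B\,\Psi(t)$ for $0<t<\varepsilon$; and (ii) $u$ is the infimum of all $0<v\le\infty$ for which, for some $c>0$ and a fixed sufficiently small $\varepsilon>0$, $$\left(-\int_0^\varepsilon\left(\frac{f^*(t)}{\Psi(t)}\right)^v\frac{\Psi'(t)}{\Psi(t)}\,dt\right)^{1/v}\le c\,\|f\|_X\quad\text{for all }f\in X$$ (for $v=\infty$: $\sup_{0<t<\varepsilon}f^*(t)/\Psi(t)\le c\|f\|_X$). For $\Psi(t)=t^{-1/r}$ the measure $-\frac{\Psi'(t)}{\Psi(t)}dt$ is a constant multiple of $\frac{dt}{t}$. *)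

theory Defs
  imports "HOL-Probability.Essential_Supremum"
begin

text \<open>
  Powers of extended nonnegative reals; only positive real exponents are used, so
  the value \<open>\<infinity>\<close> at \<open>\<infinity>\<close> is the right one.
\<close>

definition enn_powr :: "ennreal \<Rightarrow> real \<Rightarrow> ennreal" where
  "enn_powr x a = (if x = \<infinity> then \<infinity> else ennreal (enn2real x powr a))"

definition Lq_norm :: "'a measure \<Rightarrow> ennreal \<Rightarrow> ('a \<Rightarrow> ennreal) \<Rightarrow> ennreal" where
  "Lq_norm M q g =
     (if q = \<infinity> then esssup M g
      else enn_powr (\<integral>\<^sup>+x. enn_powr (g x) (enn2real q) \<partial>M) (1 / enn2real q))"


text \<open>
  Points of \<open>\<real>\<^sup>d\<close> are extensional functions on the index set \<open>{1..d}\<close>.  The completion of the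
  product of the one-dimensional Borel-Lebesgue measures is \<open>d\<close>-dimensional Lebesgue measure;
  its restriction to the product set \<open>\<Omega>\<^sub>1 \<times> \<dots> \<times> \<Omega>\<^sub>d\<close> is the measure called \<open>\<mu>\<close>.
\<close>

definition prod_lebesgue_on :: "nat \<Rightarrow> (nat \<Rightarrow> real set) \<Rightarrow> (nat \<Rightarrow> real) measure" where
  "prod_lebesgue_on d \<Omega> =
     restrict_space (completion (Pi\<^sub>M {1..d} (\<lambda>_. lborel))) (Pi\<^sub>E {1..d} \<Omega>)"

text \<open>
  \<open>mixed_iter \<Omega> p f k x\<close> is the result of taking the \<open>L\<^bsub>p\<^sub>1\<^esub>\<close> quasi-norm of \<open>f\<close> in the first
  variable, then the \<open>L\<^bsub>p\<^sub>2\<^esub>\<close> quasi-norm in the second one, and so on up to the \<open>k\<close>-th variable.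
  It depends only on the coordinates of \<open>x\<close> with index larger than \<open>k\<close>.  After \<open>d\<close> steps no
  coordinate in \<open>{1..d}\<close> is left, hence the dummy base point in \<open>mixed_norm\<close>, which keeps
  all evaluation points of \<open>f\<close> in \<open>Pi\<^sub>E {1..d} \<Omega>\<close>.  For Lebesgue measurable \<open>f\<close> the inner
  functions are measurable only almost everywhere; the exceptional null sets affect neither
  the integrals nor the essential suprema, because each coordinate carries the complete
  Lebesgue measure.
\<close>

primrec mixed_iter ::
  "(nat \<Rightarrow> real set) \<Rightarrow> (nat \<Rightarrow> ennreal) \<Rightarrow> ((nat \<Rightarrow> real) \<Rightarrow> real) \<Rightarrow> nat \<Rightarrow> (nat \<Rightarrow> real) \<Rightarrow> ennreal"
where
  "mixed_iter \<Omega> p f 0 x = ennreal \<bar>f x\<bar>"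
| "mixed_iter \<Omega> p f (Suc k) x =
     Lq_norm (lebesgue_on (\<Omega> (Suc k))) (p (Suc k)) (\<lambda>t. mixed_iter \<Omega> p f k (x(Suc k := t)))"

definition mixed_norm ::
  "nat \<Rightarrow> (nat \<Rightarrow> real set) \<Rightarrow> (nat \<Rightarrow> ennreal) \<Rightarrow> ((nat \<Rightarrow> real) \<Rightarrow> real) \<Rightarrow> ennreal" where
  "mixed_norm d \<Omega> p f = mixed_iter \<Omega> p f d (\<lambda>_. undefined)"

definition mixed_Lp ::
  "nat \<Rightarrow> (nat \<Rightarrow> real set) \<Rightarrow> (nat \<Rightarrow> ennreal) \<Rightarrow> ((nat \<Rightarrow> real) \<Rightarrow> real) set" where
  "mixed_Lp d \<Omega> p =
     {f. f \<in> borel_measurable (prod_lebesgue_on d \<Omega>) \<and> mixed_norm d \<Omega> p f < \<infinity>}"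


definition distribution_function :: "'a measure \<Rightarrow> ('a \<Rightarrow> real) \<Rightarrow> real \<Rightarrow> ennreal" where
  "distribution_function M f s = emeasure M {x \<in> space M. \<bar>f x\<bar> > s}"

definition rearrangement :: "'a measure \<Rightarrow> ('a \<Rightarrow> real) \<Rightarrow> real \<Rightarrow> ennreal" where
  "rearrangement M f t =
     Inf {ennreal s | s. s > 0 \<and> distribution_function M f s \<le> ennreal t}"


text \<open>
  In what follows a quasi-normed function space over \<open>M\<close> is given by its set \<open>X\<close> of functions
  and its quasi-norm \<open>N\<close>.
\<close>

definition growth_envelope_function ::
  "'a measure \<Rightarrow> ('a \<Rightarrow> real) set \<Rightarrow> (('a \<Rightarrow> real) \<Rightarrow> ennreal) \<Rightarrow> real \<Rightarrow> ennreal" where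
  "growth_envelope_function M X N t = (SUP f\<in>{f \<in> X. N f \<le> 1}. rearrangement M f t)"

text \<open>
  The left-hand side of the inequality defining the additional index of the envelope.
  The weight \<open>- \<Psi>' / \<Psi>\<close> is nonnegative for decreasing \<open>\<Psi>\<close>, so no information is lost by \<open>ennreal\<close>.
\<close>

definition envelope_functional ::
  "'a measure \<Rightarrow> (real \<Rightarrow> real) \<Rightarrow> real \<Rightarrow> ennreal \<Rightarrow> ('a \<Rightarrow> real) \<Rightarrow> ennreal" where
  "envelope_functional M \<Psi> \<epsilon> v f =
     (if v = \<infinity> then (SUP t\<in>{0<..<\<epsilon>}. rearrangement M f t / ennreal (\<Psi> t))
      else enn_powr
        (\<integral>\<^sup>+t\<in>{0<..<\<epsilon>}. enn_powr (rearrangement M f t / ennreal (\<Psi> t)) (enn2real v)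
                         * ennreal (- (deriv \<Psi> t / \<Psi> t)) \<partial>lborel)
        (1 / enn2real v))"

definition envelope_exponents ::
  "'a measure \<Rightarrow> ('a \<Rightarrow> real) set \<Rightarrow> (('a \<Rightarrow> real) \<Rightarrow> ennreal) \<Rightarrow> (real \<Rightarrow> real) \<Rightarrow> real \<Rightarrow> ennreal set"
where
  "envelope_exponents M X N \<Psi> \<epsilon> =
     {v. 0 < v \<and> (\<exists>c>0. \<forall>f\<in>X. envelope_functional M \<Psi> \<epsilon> v f \<le> ennreal c * N f)}"

text \<open>
  Growth envelopes only concern the behaviour near \<open>0\<close>, so \<open>\<Psi>\<close> is required to be positive,
  decreasing and continuously differentiable on some interval \<open>(0,\<delta>)\<close>.  The index is the
  infimum for each fixed sufficiently small \<open>\<epsilon>\<close>, the same \<open>\<epsilon>\<close> serving all exponents.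
\<close>

definition has_growth_envelope ::
  "'a measure \<Rightarrow> ('a \<Rightarrow> real) set \<Rightarrow> (('a \<Rightarrow> real) \<Rightarrow> ennreal) \<Rightarrow> (real \<Rightarrow> real) \<times> ennreal \<Rightarrow> bool"
where
  "has_growth_envelope M X N = (\<lambda>(\<Psi>, u).
     0 < u \<and>
     (\<exists>\<delta>>0. (\<forall>t\<in>{0<..<\<delta>}. 0 < \<Psi> t) \<and> antimono_on {0<..<\<delta>} \<Psi> \<and>
        (\<forall>t\<in>{0<..<\<delta>}. \<Psi> differentiable (at t)) \<and> continuous_on {0<..<\<delta>} (deriv \<Psi>)) \<and>
     (\<exists>\<epsilon>>0. \<exists>A>0. \<exists>B>0. \<forall>t\<in>{0<..<\<epsilon>}.
        ennreal (A * \<Psi> t) \<le> growth_envelope_function M X N t \<and>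
        growth_envelope_function M X N t \<le> ennreal (B * \<Psi> t)) \<and>
     (\<exists>\<epsilon>\<^sub>0>0. \<forall>\<epsilon>\<in>{0<..<\<epsilon>\<^sub>0}. u = Inf (envelope_exponents M X N \<Psi> \<epsilon>)))"

end

theory Submission
  imports Defs "HOL-Probability.Distribution_Functions" "HOL-Real_Asymp.Real_Asymp"
begin

text \<open>
  Let \<open>P\<close> be the smallest exponent.  On a set of finite measure \<open>L\<^bsub>q\<^esub>\<close> embeds into \<open>L\<^bsub>P\<^esub>\<close> for
  \<open>q \<ge> P\<close>; applying this in each variable and Tonelli's theorem, the mixed quasi-norm dominates
  the \<open>L\<^bsub>P\<^esub>\<close> quasi-norm on the product.  As the integral of the \<open>P\<close>-th power of the rearrangement is
  at most that of the function, this yields the upper bound of the envelope function and the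
  admissibility of the exponent \<open>P\<close>.

  Both lower bounds come from functions of a single coordinate \<open>x\<^sub>j\<close> with \<open>p\<^sub>j = P\<close>, whose mixed
  quasi-norm is a constant multiple of their \<open>L\<^bsub>P\<^esub>\<close> quasi-norm in that coordinate.  Normalised
  indicators give the envelope function.  Staircases with dyadic steps approximating
  \<open>t powr (-1 / P)\<close> on \<open>[2 powr (-n), 1]\<close> have quasi-norm of order \<open>n powr (1 / P)\<close>, whereas the
  functional with exponent \<open>v\<close> is of order \<open>n powr (1 / v)\<close>, so \<open>v < P\<close> is impossible.
\<close>

section \<open>Powers and lower integrals\<close>

lemma enn_powr_ennreal: "0 \<le> x \<Longrightarrow> enn_powr (ennreal x) a = ennreal (x powr a)"
  by (simp add: enn_powr_def)

lemma enn_powr_top [simp]: "enn_powr \<infinity> a = \<infinity>" "enn_powr top a = top"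
  by (simp_all add: enn_powr_def)

lemma enn_powr_zero [simp]: "enn_powr 0 a = 0"
  by (simp add: enn_powr_def)

lemma enn_powr_one [simp]: "enn_powr 1 a = 1"
  by (simp add: enn_powr_def)

lemma enn_powr_by_one [simp]: "enn_powr x 1 = x"
  by (cases x) (auto simp: enn_powr_ennreal)

lemma enn_powr_mono: "0 \<le> a \<Longrightarrow> x \<le> y \<Longrightarrow> enn_powr x a \<le> enn_powr y a"
  by (cases x; cases y) (auto simp: enn_powr_ennreal powr_mono2 top_unique intro!: ennreal_leI)

lemma enn_powr_powr: "enn_powr (enn_powr x a) b = enn_powr x (a * b)"
  by (cases x) (auto simp: enn_powr_ennreal powr_powr)

lemma enn_powr_mult: "0 < a \<Longrightarrow> enn_powr (x * y) a = enn_powr x a * enn_powr y a"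
  by (cases x; cases y) (auto simp: enn_powr_ennreal powr_mult ennreal_mult'[symmetric]
      ennreal_top_mult ennreal_mult_top)

lemma enn_powr_le_iff: "0 < a \<Longrightarrow> enn_powr x a \<le> y \<longleftrightarrow> x \<le> enn_powr y (1 / a)"
  using enn_powr_mono[of a x "enn_powr y (1/a)"] enn_powr_mono[of "1/a" "enn_powr x a" y]
  by (auto simp: enn_powr_powr)

lemma enn_powr_less_iff: "0 < a \<Longrightarrow> y < enn_powr x a \<longleftrightarrow> enn_powr y (1 / a) < x"
  using enn_powr_le_iff[of a x y] by (simp add: not_le[symmetric])

lemma borel_measurable_enn_powr [measurable]:
  assumes [measurable]: "f \<in> borel_measurable M"
  shows "(\<lambda>x. enn_powr (f x) a) \<in> borel_measurable M"
  unfolding enn_powr_def by measurable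

text \<open>
  The inner iterates of a Lebesgue measurable function need not be measurable.  The following
  inequalities hold for the lower integral, which is the value of the nonnegative integral at
  a nonmeasurable function, and so apply to the iterates directly.
\<close>

lemma nn_integral_cmult_pos:
  fixes f :: "'a \<Rightarrow> ennreal" and c :: real
  assumes "0 < c"
  shows "(\<integral>\<^sup>+x. ennreal c * f x \<partial>M) = ennreal c * (\<integral>\<^sup>+x. f x \<partial>M)"
proof -
  have inv: "ennreal c * (ennreal (1 / c) * y) = y" "ennreal (1 / c) * (ennreal c * y) = y"
    if "0 < c" for c y
    using that by (simp_all add: mult.assoc[symmetric] ennreal_mult'[symmetric])
  \<comment> \<open>Proved for all c and f at once: the reverse inequality is this one for 1 / c and
    the function c f. Scalars are moved only through integrals of the simple, hence measurable,
    minorant s.\<close>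
  have le: "(\<integral>\<^sup>+x. ennreal c * f x \<partial>M) \<le> ennreal c * (\<integral>\<^sup>+x. f x \<partial>M)"
    if c: "0 < c" for c and f :: "'a \<Rightarrow> ennreal"
    unfolding nn_integral_def[of M "\<lambda>x. ennreal c * f x"]
  proof (safe intro!: SUP_least)
    fix s assume s: "simple_function M s" "s \<le> (\<lambda>x. ennreal c * f x)"
    have [measurable]: "s \<in> borel_measurable M"
      using s(1) by (rule borel_measurable_simple_function)
    have "integral\<^sup>S M s = (\<integral>\<^sup>+x. ennreal c * (ennreal (1 / c) * s x) \<partial>M)"
      using s(1) by (simp add: nn_integral_eq_simple_integral inv[OF c])
    also have "\<dots> = ennreal c * (\<integral>\<^sup>+x. ennreal (1 / c) * s x \<partial>M)"
      by (rule nn_integral_cmult) measurable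
    also have "\<dots> \<le> ennreal c * (\<integral>\<^sup>+x. ennreal (1 / c) * (ennreal c * f x) \<partial>M)"
      using s(2) by (intro mult_left_mono nn_integral_mono) (auto simp: le_fun_def)
    finally show "integral\<^sup>S M s \<le> ennreal c * (\<integral>\<^sup>+x. f x \<partial>M)" by (simp add: inv[OF c])
  qed
  have "ennreal c * (\<integral>\<^sup>+x. f x \<partial>M) = ennreal c * (\<integral>\<^sup>+x. ennreal (1 / c) * (ennreal c * f x) \<partial>M)"
    by (simp add: inv[OF assms])
  also have "\<dots> \<le> ennreal c * (ennreal (1 / c) * (\<integral>\<^sup>+x. ennreal c * f x \<partial>M))"
    using assms by (intro mult_left_mono le) auto
  also have "\<dots> = (\<integral>\<^sup>+x. ennreal c * f x \<partial>M)" by (rule inv[OF assms])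
  finally show ?thesis using le[OF assms] by (rule antisym[rotated])
qed

text \<open>Up to \<delta> the first summand dominates; beyond it \<open>y powr (P - Q)\<close> is
  at most \<open>\<delta> powr (P - Q)\<close>. This pointwise bound takes the place of Hoelder's
  inequality.\<close>

lemma powr_le_scaled_sum:
  fixes y \<delta> P Q :: real
  assumes "0 \<le> y" "0 < \<delta>" "0 < P" "P \<le> Q"
  shows "y powr P \<le> \<delta> powr P + \<delta> powr (P - Q) * y powr Q"
proof (cases "y \<le> \<delta>")
  case True
  then have "y powr P \<le> \<delta> powr P" using assms by (intro powr_mono2) auto
  then show ?thesis by (simp add: add_increasing2)
next
  case False
  then have "y powr P = y powr (P - Q) * y powr Q" using assms by (simp add: powr_add[symmetric])
  also have "\<dots> \<le> \<delta> powr (P - Q) * y powr Q"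
    using False assms by (intro mult_right_mono powr_mono2') auto
  finally show ?thesis by (simp add: add_increasing)
qed

text \<open>Lower integrals are not additive, so the pointwise bound is integrated for a simple
  minorant u of the P-th power of g; \<open>enn_powr (u x) (Q / P)\<close> is then a measurable
  minorant of the Q-th power. With \<delta> in the role of the L_Q norm both summands scale like
  \<open>\<delta> powr P\<close>.\<close>

lemma nn_integral_powr_le_scaled:
  fixes g :: "'a \<Rightarrow> ennreal" and P Q \<delta> :: real
  assumes "0 < P" "P \<le> Q" "0 < \<delta>"
    and I: "(\<integral>\<^sup>+x. enn_powr (g x) Q \<partial>M) \<le> ennreal (\<delta> powr Q)"
  shows "(\<integral>\<^sup>+x. enn_powr (g x) P \<partial>M) \<le> (emeasure M (space M) + 1) * ennreal (\<delta> powr P)"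
  unfolding nn_integral_def[of M "\<lambda>x. enn_powr (g x) P"]
proof (safe intro!: SUP_least)
  fix u assume u: "simple_function M u" "u \<le> (\<lambda>x. enn_powr (g x) P)"
  have [measurable]: "u \<in> borel_measurable M"
    using u(1) by (rule borel_measurable_simple_function)
  \<comment> \<open>This is \<open>powr_le_scaled_sum\<close> for the P-th root of u x. Where u x is
    infinite, so is the right-hand side, because its coefficient is positive.\<close>
  have bound: "u x \<le> ennreal (\<delta> powr P) + ennreal (\<delta> powr (P - Q)) * enn_powr (u x) (Q / P)" for x
  proof (cases "u x")
    case (real r)
    have "r = (r powr (1/P)) powr P" using real assms by (simp add: powr_powr)
    also have "\<dots> \<le> \<delta> powr P + \<delta> powr (P - Q) * (r powr (1/P)) powr Q"
      using assms real by (intro powr_le_scaled_sum) auto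
    finally have "ennreal r \<le> ennreal (\<delta> powr P + \<delta> powr (P - Q) * (r powr (Q/P)))"
      by (intro ennreal_leI) (simp add: powr_powr)
    then show ?thesis using real
      by (simp add: enn_powr_ennreal ennreal_plus ennreal_mult)
  qed (use assms in \<open>simp add: ennreal_mult_top\<close>)
  have "integral\<^sup>S M u \<le> (\<integral>\<^sup>+x. ennreal (\<delta> powr P) + ennreal (\<delta> powr (P - Q)) * enn_powr (u x) (Q / P) \<partial>M)"
    unfolding nn_integral_eq_simple_integral[OF u(1), symmetric]
    by (intro nn_integral_mono bound)
  also have "\<dots> = ennreal (\<delta> powr P) * emeasure M (space M)
      + ennreal (\<delta> powr (P - Q)) * (\<integral>\<^sup>+x. enn_powr (u x) (Q / P) \<partial>M)"
    by (simp add: nn_integral_add nn_integral_cmult)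
  finally have *: "integral\<^sup>S M u \<le> \<dots>" .
  have "(\<integral>\<^sup>+x. enn_powr (u x) (Q / P) \<partial>M) \<le> (\<integral>\<^sup>+x. enn_powr (g x) Q \<partial>M)"
  proof (rule nn_integral_mono)
    fix x
    have "enn_powr (u x) (Q / P) \<le> enn_powr (enn_powr (g x) P) (Q / P)"
      using u(2) assms by (intro enn_powr_mono) (auto simp: le_fun_def)
    then show "enn_powr (u x) (Q / P) \<le> enn_powr (g x) Q"
      using assms by (simp add: enn_powr_powr)
  qed
  also note I
  finally have "ennreal (\<delta> powr (P - Q)) * (\<integral>\<^sup>+x. enn_powr (u x) (Q / P) \<partial>M)
      \<le> ennreal (\<delta> powr (P - Q)) * ennreal (\<delta> powr Q)"
    by (rule mult_left_mono) simp
  also have "\<dots> = ennreal (\<delta> powr P)"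
    using assms by (simp add: ennreal_mult'[symmetric] powr_add[symmetric])
  finally have "integral\<^sup>S M u \<le> ennreal (\<delta> powr P) * emeasure M (space M) + ennreal (\<delta> powr P)"
    by (rule order_trans[OF * add_left_mono])
  then show "integral\<^sup>S M u \<le> (emeasure M (space M) + 1) * ennreal (\<delta> powr P)"
    by (simp add: mult.commute[of _ "ennreal (\<delta> powr P)"] distrib_left)
qed

text \<open>The embedding of L_q into L_P. For finite q it is the previous estimate with the L_q
  norm of g as \<delta>; for infinite q it holds since g is almost everywhere below its essential
  supremum.\<close>

lemma nn_integral_powr_le_Lq_norm:
  fixes g :: "'a \<Rightarrow> ennreal" and P :: real
  assumes fin: "emeasure M (space M) < \<infinity>" and P: "0 < P" "ennreal P \<le> q"
  shows "(\<integral>\<^sup>+x. enn_powr (g x) P \<partial>M)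
    \<le> (emeasure M (space M) + 1) * enn_powr (Lq_norm M q g) P"
proof (cases "q = \<infinity>")
  case True
  have "(\<integral>\<^sup>+x. enn_powr (g x) P \<partial>M) \<le> (\<integral>\<^sup>+x. enn_powr (esssup M g) P \<partial>M)"
    using esssup_AE[of g M] P by (intro nn_integral_mono_AE) (auto intro: enn_powr_mono elim!: eventually_mono)
  also have "\<dots> = emeasure M (space M) * enn_powr (esssup M g) P" by (simp add: mult.commute)
  also have "\<dots> \<le> (emeasure M (space M) + 1) * enn_powr (esssup M g) P"
    by (intro mult_right_mono) auto
  finally show ?thesis using True by (simp add: Lq_norm_def)
next
  case False
  define Q where "Q = enn2real q"
  have q: "q = ennreal Q" and PQ: "P \<le> Q" "0 < Q"
    using False P by (cases q; auto simp: Q_def)+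
  define I where "I = (\<integral>\<^sup>+x. enn_powr (g x) Q \<partial>M)"
  have N: "enn_powr (Lq_norm M q g) P = enn_powr I (P / Q)"
    using False by (simp add: Lq_norm_def I_def enn_powr_powr Q_def)
  obtain m where m: "emeasure M (space M) + 1 = ennreal m" "0 < m"
    using fin by (cases "emeasure M (space M)")
      (auto simp: ennreal_plus[symmetric] simp flip: ennreal_1 simp del: ennreal_plus)
  show ?thesis
  proof (cases I)
    case top
    then show ?thesis using m by (simp add: N ennreal_mult_top)
  next
    case (real i)
    show ?thesis
    \<comment> \<open>The value \<delta> = 0 is not admissible. If the Q-integral vanishes, every
      positive \<delta> is, and \<open>(e / m) powr (1 / P)\<close> makes the bound equal to
      e.\<close>
    proof (cases "i = 0")
      case True
      have "(\<integral>\<^sup>+x. enn_powr (g x) P \<partial>M) \<le> 0 + ennreal e" if "0 < e" for e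
      proof -
        have "(\<integral>\<^sup>+x. enn_powr (g x) P \<partial>M)
            \<le> (emeasure M (space M) + 1) * ennreal (((e / m) powr (1/P)) powr P)"
          using that P PQ m True real
          by (intro nn_integral_powr_le_scaled[where Q = Q]) (auto simp: I_def[symmetric])
        also have "\<dots> = ennreal e"
          using that m P by (simp add: powr_powr ennreal_mult'[symmetric])
        finally show ?thesis by simp
      qed
      then have "(\<integral>\<^sup>+x. enn_powr (g x) P \<partial>M) \<le> 0" by (rule ennreal_le_epsilon)
      then show ?thesis by simp
    next
      case False
      have "(\<integral>\<^sup>+x. enn_powr (g x) P \<partial>M)
          \<le> (emeasure M (space M) + 1) * ennreal ((i powr (1/Q)) powr P)"
        using P PQ False real
        by (intro nn_integral_powr_le_scaled[where Q = Q]) (auto simp: I_def[symmetric] powr_powr)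
      then show ?thesis using real by (simp add: N enn_powr_ennreal powr_powr)
    qed
  qed
qed

section \<open>Iterated integrals and mixed quasi-norms\<close>

text \<open>Same recursion pattern as \<open>mixed_iter\<close>. The measures are a parameter
  because it is run both with \<open>lborel\<close>, where Tonelli's theorem applies, and with
  Lebesgue measure on the sets \<Omega> i.\<close>

primrec iterated_nn_integral ::
  "(nat \<Rightarrow> 'b measure) \<Rightarrow> ((nat \<Rightarrow> 'b) \<Rightarrow> ennreal) \<Rightarrow> nat \<Rightarrow> (nat \<Rightarrow> 'b) \<Rightarrow> ennreal"
where
  "iterated_nn_integral M h 0 x = h x"
| "iterated_nn_integral M h (Suc k) x =
     (\<integral>\<^sup>+t. iterated_nn_integral M h k (x(Suc k := t)) \<partial>M (Suc k))"

text \<open>Tonelli's theorem, one coordinate per step. Measurability of the iterate belongs to the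
  induction because splitting off the next coordinate requires it.\<close>

lemma iterated_nn_integral_PiM:
  fixes M :: "nat \<Rightarrow> 'b measure"
  assumes "product_sigma_finite M" and "h \<in> borel_measurable (Pi\<^sub>M {1..d} M)" "k \<le> d"
  shows "iterated_nn_integral M h k \<in> borel_measurable (Pi\<^sub>M {Suc k..d} M) \<and>
    integral\<^sup>N (Pi\<^sub>M {Suc k..d} M) (iterated_nn_integral M h k) = integral\<^sup>N (Pi\<^sub>M {1..d} M) h"
  using assms(3)
proof (induction k)
  case 0
  then show ?case using assms(2) by simp
next
  case (Suc k)
  define J where "J = iterated_nn_integral M h k"
  have ins: "insert (Suc k) {Suc (Suc k)..d} = {Suc k..d}" using Suc.prems by auto
  have J[measurable]: "J \<in> borel_measurable (Pi\<^sub>M (insert (Suc k) {Suc (Suc k)..d}) M)"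
    using Suc unfolding ins J_def by simp
  interpret product_sigma_finite M by (rule assms(1))
  interpret sigma_finite_measure "M (Suc k)" by (rule sigma_finite_measures)
  have eq: "iterated_nn_integral M h (Suc k) = (\<lambda>x. \<integral>\<^sup>+t. J (x(Suc k := t)) \<partial>M (Suc k))"
    by (simp add: J_def fun_eq_iff)
  have "(\<lambda>x. \<integral>\<^sup>+t. J (x(Suc k := t)) \<partial>M (Suc k)) \<in> borel_measurable (Pi\<^sub>M {Suc (Suc k)..d} M)"
    by measurable
  moreover have "(\<integral>\<^sup>+x. (\<integral>\<^sup>+t. J (x(Suc k := t)) \<partial>M (Suc k)) \<partial>Pi\<^sub>M {Suc (Suc k)..d} M)
      = integral\<^sup>N (Pi\<^sub>M (insert (Suc k) {Suc (Suc k)..d}) M) J"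
    by (rule product_nn_integral_insert[symmetric]) auto
  ultimately show ?case using Suc unfolding eq ins J_def by simp
qed

text \<open>The iterates of F may be nonmeasurable, so integrals over the line are compared with
  integrals over \<Omega> i coordinate by coordinate, using monotonicity. The indicator of the box
  splits into that of one factor and that of the remaining ones.\<close>

lemma iterated_nn_integral_mono_box:
  fixes h F :: "(nat \<Rightarrow> real) \<Rightarrow> ennreal"
  assumes \<Omega>: "\<And>i. i \<in> {1..d} \<Longrightarrow> \<Omega> i \<in> sets lebesgue"
    and le: "\<And>x. x \<in> extensional {1..d} \<Longrightarrow> h x \<le> F x * indicator (Pi\<^sub>E {1..d} \<Omega>) x"
    and "k \<le> d" "x \<in> extensional {Suc k..d}"
  shows "iterated_nn_integral (\<lambda>_. lborel) h k x
    \<le> iterated_nn_integral (\<lambda>i. lebesgue_on (\<Omega> i)) F k x * indicator (Pi\<^sub>E {Suc k..d} \<Omega>) x"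
  using assms(3,4)
proof (induction k arbitrary: x)
  case 0
  then show ?case using le by simp
next
  case (Suc k)
  let ?G = "iterated_nn_integral (\<lambda>i. lebesgue_on (\<Omega> i)) F k"
  have ins: "{Suc k..d} = insert (Suc k) {Suc (Suc k)..d}" using Suc.prems by auto
  have meas: "\<Omega> (Suc k) \<in> sets lebesgue" using Suc.prems by (intro \<Omega>) auto
  have "iterated_nn_integral (\<lambda>_. lborel) h (Suc k) x
      \<le> (\<integral>\<^sup>+t. ?G (x(Suc k := t)) * indicator (Pi\<^sub>E {Suc k..d} \<Omega>) (x(Suc k := t)) \<partial>lborel)"
    using Suc.prems by (auto intro!: nn_integral_mono Suc.IH simp: extensional_def)
  \<comment> \<open>A measure and its completion give the same lower integral for every function,
    measurable or not.\<close>
  also have "\<dots> = (\<integral>\<^sup>+t. ?G (x(Suc k := t)) * indicator (\<Omega> (Suc k)) t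
      * indicator (Pi\<^sub>E {Suc (Suc k)..d} \<Omega>) x \<partial>lebesgue)"
    unfolding nn_integral_completion
    using Suc.prems(2)
    by (intro nn_integral_cong) (auto simp: ins indicator_def PiE_iff extensional_def)
  also have "\<dots> \<le> iterated_nn_integral (\<lambda>i. lebesgue_on (\<Omega> i)) F (Suc k) x
      * indicator (Pi\<^sub>E {Suc (Suc k)..d} \<Omega>) x"
    using meas by (simp add: nn_integral_restrict_space indicator_def)
  finally show ?case .
qed

lemma prod_nn_integral_le_iterated:
  assumes \<Omega>: "\<And>i. i \<in> {1..d} \<Longrightarrow> \<Omega> i \<in> sets lebesgue"
    and box: "Pi\<^sub>E {1..d} \<Omega> \<in> sets (completion (Pi\<^sub>M {1..d} (\<lambda>_. lborel)))"
    and F: "F \<in> borel_measurable (prod_lebesgue_on d \<Omega>)"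
  shows "integral\<^sup>N (prod_lebesgue_on d \<Omega>) F
    \<le> iterated_nn_integral (\<lambda>i. lebesgue_on (\<Omega> i)) F d (\<lambda>_. undefined)"
proof -
  let ?S = "Pi\<^sub>E {1..d} \<Omega>" and ?P = "Pi\<^sub>M {1..d} (\<lambda>_. lborel :: real measure)"
  interpret product_sigma_finite "\<lambda>_. lborel :: real measure" ..
  have "(\<lambda>x. F x * indicator ?S x) \<in> borel_measurable (completion ?P)"
    using F box unfolding prod_lebesgue_on_def
    by (subst borel_measurable_restrict_space_iff_ennreal[symmetric]) auto
  \<comment> \<open>\<open>h\<close> below is a Borel minorant of \<open>F\<close>, equal to it almost everywhere: Tonelli applies to \<open>h\<close>,
    and the passage back to \<open>F\<close> only uses monotonicity.\<close>
  from completion_ex_borel_measurable[OF this]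
  obtain g where g[measurable]: "g \<in> borel_measurable ?P"
    and ae: "AE x in ?P. F x * indicator ?S x = g x" by blast
  obtain N where N: "N \<in> null_sets ?P"
      "\<And>x. x \<in> space ?P - N \<Longrightarrow> F x * indicator ?S x = g x"
    using ae by (rule AE_E3) blast
  have [measurable]: "N \<in> sets ?P" using N by auto
  define h where "h = (\<lambda>x. g x * indicator (space ?P - N) x)"
  have h[measurable]: "h \<in> borel_measurable ?P" unfolding h_def by measurable
  have h_le: "h x \<le> F x * indicator ?S x" if "x \<in> extensional {1..d}" for x
    using N(2)[of x] that by (cases "x \<in> N") (simp_all add: h_def space_PiM PiE_def)
  have "integral\<^sup>N (prod_lebesgue_on d \<Omega>) F = (\<integral>\<^sup>+x. F x * indicator ?S x \<partial>?P)"
    unfolding prod_lebesgue_on_def using box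
    by (subst nn_integral_restrict_space) (auto simp: nn_integral_completion)
  also have "\<dots> = integral\<^sup>N ?P h"
  proof (rule nn_integral_cong_AE)
    show "AE x in ?P. F x * indicator ?S x = h x"
      using ae AE_not_in[OF N(1)] AE_space[of ?P] by eventually_elim (simp add: h_def)
  qed
  also have "\<dots> = integral\<^sup>N (Pi\<^sub>M {Suc d..d} (\<lambda>_. lborel)) (iterated_nn_integral (\<lambda>_. lborel) h d)"
    using iterated_nn_integral_PiM[OF product_sigma_finite_axioms h, of d] by simp
  \<comment> \<open>No coordinate is left: \<open>{Suc d..d}\<close> is empty, and the product
    measure is the unit mass at the everywhere undefined point, the base point of
    \<open>mixed_norm\<close>.\<close>
  also have "\<dots> = iterated_nn_integral (\<lambda>_. lborel) h d (\<lambda>_. undefined)"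
    by (simp add: nn_integral_empty)
  also have "\<dots> \<le> iterated_nn_integral (\<lambda>i. lebesgue_on (\<Omega> i)) F d (\<lambda>_. undefined)
      * indicator (Pi\<^sub>E {Suc d..d} \<Omega>) (\<lambda>_. undefined)"
    using \<Omega> h_le by (rule iterated_nn_integral_mono_box) (auto simp: extensional_def)
  also have "\<dots> = iterated_nn_integral (\<lambda>i. lebesgue_on (\<Omega> i)) F d (\<lambda>_. undefined)"
    by simp
  finally show ?thesis .
qed

text \<open>Each variable costs one application of the embedding, hence a factor m, the measure of
  that \<Omega> i plus one. The constant is uniform in f and x so that it can be pulled out of the
  next integral.\<close>

lemma iterated_nn_integral_le_mixed_iter:
  assumes \<Omega>: "\<And>i. i \<in> {1..d} \<Longrightarrow> \<Omega> i \<in> sets lebesgue"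
    and fin: "\<And>i. i \<in> {1..d} \<Longrightarrow> emeasure lebesgue (\<Omega> i) < \<infinity>"
    and P: "0 < P" "\<And>i. i \<in> {1..d} \<Longrightarrow> ennreal P \<le> p i"
    and "k \<le> d"
  shows "\<exists>C>0. \<forall>f x. iterated_nn_integral (\<lambda>i. lebesgue_on (\<Omega> i)) (\<lambda>x. enn_powr (ennreal \<bar>f x\<bar>) P) k x
    \<le> ennreal C * enn_powr (mixed_iter \<Omega> p f k x) P"
  using assms(5)
proof (induction k)
  case 0
  show ?case by (rule exI[of _ 1]) simp
next
  case (Suc k)
  let ?I = "\<lambda>f. iterated_nn_integral (\<lambda>i. lebesgue_on (\<Omega> i)) (\<lambda>x. enn_powr (ennreal \<bar>f x\<bar>) P)"
  let ?L = "lebesgue_on (\<Omega> (Suc k))"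
  obtain C where C: "0 < C" "\<And>f x. ?I f k x \<le> ennreal C * enn_powr (mixed_iter \<Omega> p f k x) P"
    using Suc by auto
  have i: "Suc k \<in> {1..d}" using Suc.prems by auto
  have sp: "emeasure ?L (space ?L) = emeasure lebesgue (\<Omega> (Suc k))"
    using \<Omega>[OF i] by (simp add: emeasure_restrict_space)
  obtain m where m: "emeasure ?L (space ?L) + 1 = ennreal m" "0 < m"
    using fin[OF i] unfolding sp by (cases "emeasure lebesgue (\<Omega> (Suc k))")
      (auto simp: ennreal_plus[symmetric] simp flip: ennreal_1 simp del: ennreal_plus)
  have "?I f (Suc k) x \<le> ennreal (C * m) * enn_powr (mixed_iter \<Omega> p f (Suc k) x) P" for f x
  proof -
    have "?I f (Suc k) x \<le> (\<integral>\<^sup>+t. ennreal C * enn_powr (mixed_iter \<Omega> p f k (x(Suc k := t))) P \<partial>?L)"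
      using C(2) by (auto intro!: nn_integral_mono)
    also have "\<dots> = ennreal C * (\<integral>\<^sup>+t. enn_powr (mixed_iter \<Omega> p f k (x(Suc k := t))) P \<partial>?L)"
      by (rule nn_integral_cmult_pos[OF C(1)])
    also have "\<dots> \<le> ennreal C * (ennreal m * enn_powr (mixed_iter \<Omega> p f (Suc k) x) P)"
      unfolding m(1)[symmetric] mixed_iter.simps
      using fin[OF i] P i sp by (intro mult_left_mono nn_integral_powr_le_Lq_norm) auto
    finally show ?thesis using C(1) m(2) by (simp add: ennreal_mult' mult.assoc)
  qed
  then show ?case using C(1) m(2) by (intro exI[of _ "C * m"]) auto
qed

lemma nn_integral_powr_le_mixed_norm:
  assumes \<Omega>: "\<And>i. i \<in> {1..d} \<Longrightarrow> \<Omega> i \<in> sets lebesgue"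
    and fin: "\<And>i. i \<in> {1..d} \<Longrightarrow> emeasure lebesgue (\<Omega> i) < \<infinity>"
    and box: "Pi\<^sub>E {1..d} \<Omega> \<in> sets (completion (Pi\<^sub>M {1..d} (\<lambda>_. lborel)))"
    and P: "0 < P" "\<And>i. i \<in> {1..d} \<Longrightarrow> ennreal P \<le> p i"
  shows "\<exists>C>0. \<forall>f::(nat \<Rightarrow> real) \<Rightarrow> real. f \<in> borel_measurable (prod_lebesgue_on d \<Omega>) \<longrightarrow>
    (\<integral>\<^sup>+x. enn_powr (ennreal \<bar>f x\<bar>) P \<partial>prod_lebesgue_on d \<Omega>) \<le> ennreal C * enn_powr (mixed_norm d \<Omega> p f) P"
proof -
  have "\<exists>C>0. \<forall>f x. iterated_nn_integral (\<lambda>i. lebesgue_on (\<Omega> i))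
      (\<lambda>x. enn_powr (ennreal \<bar>f x\<bar>) P) d x \<le> ennreal C * enn_powr (mixed_iter \<Omega> p f d x) P"
    by (rule iterated_nn_integral_le_mixed_iter[OF \<Omega> fin P order_refl])
  then obtain C where C: "0 < C" "\<And>f x. iterated_nn_integral (\<lambda>i. lebesgue_on (\<Omega> i))
      (\<lambda>x. enn_powr (ennreal \<bar>f x\<bar>) P) d x \<le> ennreal C * enn_powr (mixed_iter \<Omega> p f d x) P"
    by blast
  show ?thesis
  proof (intro exI[of _ C] conjI allI impI)
    fix f :: "(nat \<Rightarrow> real) \<Rightarrow> real" assume [measurable]: "f \<in> borel_measurable (prod_lebesgue_on d \<Omega>)"
    show "(\<integral>\<^sup>+x. enn_powr (ennreal \<bar>f x\<bar>) P \<partial>prod_lebesgue_on d \<Omega>)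
        \<le> ennreal C * enn_powr (mixed_norm d \<Omega> p f) P"
      unfolding mixed_norm_def
      by (rule order_trans[OF prod_nn_integral_le_iterated[OF \<Omega> box] C(2)]) auto
  qed (rule C(1))
qed

section \<open>Lebesgue measure of boxes\<close>

text \<open>The factors are only Lebesgue measurable, whereas completion is taken after forming the
  product. Each A i lies between a Borel set S i and S i \<union> N i with N i null, so the boxes
  over A and S differ inside finitely many null slabs.\<close>

lemma
  fixes A :: "'i \<Rightarrow> real set"
  assumes I: "finite I" and A: "\<And>i. i \<in> I \<Longrightarrow> A i \<in> sets lebesgue"
  shows sets_completion_PiE_lebesgue: "Pi\<^sub>E I A \<in> sets (completion (Pi\<^sub>M I (\<lambda>_. lborel)))" (is ?meas)
    and emeasure_completion_PiE_lebesgue: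
      "emeasure (completion (Pi\<^sub>M I (\<lambda>_. lborel))) (Pi\<^sub>E I A) = (\<Prod>i\<in>I. emeasure lebesgue (A i))" (is ?em)
proof -
  let ?P = "Pi\<^sub>M I (\<lambda>_. lborel :: real measure)"
  interpret product_sigma_finite "\<lambda>_. lborel :: real measure" ..
  have "\<exists>S N. S \<in> sets lborel \<and> N \<in> null_sets lborel \<and> S \<subseteq> A i \<and> A i \<subseteq> S \<union> N" if i: "i \<in> I" for i
  proof -
    obtain S N N' where "A i = S \<union> N" "N \<subseteq> N'" "N' \<in> null_sets lborel" "S \<in> sets lborel"
      using A[OF i] by (rule sets_completionE)
    then show ?thesis by (intro exI[of _ S] exI[of _ N']) auto
  qed
  then obtain S N where S: "\<And>i. i \<in> I \<Longrightarrow> S i \<in> sets lborel" "\<And>i. i \<in> I \<Longrightarrow> S i \<subseteq> A i"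
    and N: "\<And>i. i \<in> I \<Longrightarrow> N i \<in> null_sets lborel" "\<And>i. i \<in> I \<Longrightarrow> A i \<subseteq> S i \<union> N i"
    by metis
  define Z where "Z = (\<Union>i\<in>I. Pi\<^sub>E I (\<lambda>j. if j = i then N i else UNIV))"
  have Z: "Z \<in> null_sets ?P"
    unfolding Z_def
  proof (rule null_sets_UN')
    fix i assume i: "i \<in> I"
    note Ni = null_setsD1[OF N(1)[OF i]] null_setsD2[OF N(1)[OF i]]
    have "emeasure ?P (Pi\<^sub>E I (\<lambda>j. if j = i then N i else UNIV))
        = (\<Prod>j\<in>I. emeasure lborel (if j = i then N i else UNIV))"
      using I Ni i by (intro emeasure_PiM) auto
    \<comment> \<open>A single zero factor annihilates the product although the other factors are
      infinite.\<close>
    also have "\<dots> = 0" using I Ni i by (intro prod_zero) auto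
    finally show "Pi\<^sub>E I (\<lambda>j. if j = i then N i else UNIV) \<in> null_sets ?P"
      using I Ni i by (auto simp: null_sets_def intro!: sets_PiM_I_finite)
  qed (use I in \<open>simp add: countable_finite\<close>)
  have meas_S: "Pi\<^sub>E I S \<in> sets ?P" using I S by (intro sets_PiM_I_finite) auto
  have D: "Pi\<^sub>E I A - Pi\<^sub>E I S \<in> null_sets (completion ?P)"
  proof (rule null_sets_completion_subset)
    show "Pi\<^sub>E I A - Pi\<^sub>E I S \<subseteq> Z"
    proof
      fix x assume x: "x \<in> Pi\<^sub>E I A - Pi\<^sub>E I S"
      then obtain i where i: "i \<in> I" "x i \<notin> S i" by (auto simp: PiE_iff)
      then have "x i \<in> N i" using x N(2)[OF i(1)] by (auto simp: PiE_iff)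
      then show "x \<in> Z" using x i by (auto simp: Z_def PiE_iff)
    qed
    show "Z \<in> null_sets (completion ?P)" using Z by (rule null_sets_completionI)
  qed
  have eq: "Pi\<^sub>E I A = Pi\<^sub>E I S \<union> (Pi\<^sub>E I A - Pi\<^sub>E I S)"
    using PiE_mono[of I S A] S by blast
  show ?meas
    by (subst eq, rule sets.Un) (use meas_S null_setsD2[OF D] in auto)
  have "emeasure lborel (S i) = emeasure lebesgue (A i)" if "i \<in> I" for i
  proof -
    have "A i - S i \<in> null_sets lebesgue"
      using N[OF that] by (intro null_sets_completion_subset[OF _ null_sets_completionI]) auto
    then have "emeasure lebesgue (S i \<union> (A i - S i)) = emeasure lebesgue (S i)"
      using S(1)[OF that] by (intro emeasure_Un_null_set) auto
    moreover have "S i \<union> (A i - S i) = A i" using S(2)[OF that] by blast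
    ultimately show ?thesis using S(1)[OF that] by simp
  qed
  moreover have "emeasure (completion ?P) (Pi\<^sub>E I A) = emeasure ?P (Pi\<^sub>E I S)"
    using meas_S D by (subst eq, subst emeasure_Un_null_set) auto
  ultimately show ?em
    using I S by (simp add: emeasure_PiM)
qed

lemma space_prod_lebesgue_on: "space (prod_lebesgue_on d \<Omega>) = Pi\<^sub>E {1..d} \<Omega>"
  by (auto simp: prod_lebesgue_on_def space_restrict_space space_PiM PiE_def)

section \<open>Rearrangements\<close>

text \<open>The layer-cake formula for one number: the set of these u is the interval from 0 to y.
  Writing values as such integrals allows the order of integration to be exchanged.\<close>

lemma nn_integral_below:
  "(\<integral>\<^sup>+u. (if 0 < u \<and> ennreal u < y then 1 else 0) \<partial>lborel) = y"
proof -
  have "(\<integral>\<^sup>+u. (if 0 < u \<and> ennreal u < y then 1 else 0) \<partial>lborel)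
      = (\<integral>\<^sup>+u. indicator {u. 0 < u \<and> ennreal u < y} u \<partial>lborel)"
    by (intro nn_integral_cong) auto
  also have "\<dots> = emeasure lborel {u. 0 < u \<and> ennreal u < y}"
    by (rule nn_integral_indicator) measurable
  also have "\<dots> = y"
  proof (cases y)
    case (real r)
    then have "{u. 0 < u \<and> ennreal u < y} = {0<..<r}" by (auto simp: ennreal_less_iff)
    then show ?thesis using real by simp
  next
    case top
    have "{u. 0 < u \<and> ennreal u < y} = {0<..}" using top by auto
    moreover have "emeasure lborel {0::real<..} = top"
    proof (cases "emeasure lborel {0::real<..}")
      case (real r)
      have "emeasure lborel {0<..<r + 1} \<le> emeasure lborel {0::real<..}"
        by (rule emeasure_mono) auto
      then show ?thesis using real by simp
    qed simp
    ultimately show ?thesis using top by simp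
  qed
  finally show ?thesis .
qed

lemma less_rearrangementD:
  "0 < s \<Longrightarrow> ennreal s < rearrangement M f t \<Longrightarrow> ennreal t < distribution_function M f s"
  unfolding rearrangement_def by (auto simp: not_le[symmetric] intro: Inf_lower)

text \<open>A competitor s < a in the infimum would have a level set containing that of a, hence of
  measure above t. The nonstrict level set suits step functions, which attain their values.\<close>

lemma rearrangement_ge:
  assumes [measurable]: "f \<in> borel_measurable M"
    and t: "ennreal t < emeasure M {x \<in> space M. a \<le> \<bar>f x\<bar>}"
  shows "ennreal a \<le> rearrangement M f t"
  unfolding rearrangement_def
proof (safe intro!: Inf_greatest ennreal_leI)
  fix s assume s: "0 < s" "distribution_function M f s \<le> ennreal t"
  show "a \<le> s"
  proof (rule ccontr)
    assume "\<not> a \<le> s"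
    then have "emeasure M {x \<in> space M. a \<le> \<bar>f x\<bar>} \<le> emeasure M {x \<in> space M. s < \<bar>f x\<bar>}"
      by (intro emeasure_mono) auto
    then show False using s t by (simp add: distribution_function_def)
  qed
qed

lemma rearrangement_antimono: "t \<le> t' \<Longrightarrow> rearrangement M f t' \<le> rearrangement M f t"
  unfolding rearrangement_def using order_trans[OF _ ennreal_leI[of t t']]
  by (intro Inf_superset_mono) blast

text \<open>Layer-cake formula on both sides: if u is below the P-th power of the rearrangement at
  t, then t < G u. Integrating over t first leaves the integral of G, which a second exchange turns
  into that of the P-th power of f.\<close>

lemma nn_integral_rearrangement_powr_le:
  assumes "sigma_finite_measure M" and [measurable]: "f \<in> borel_measurable M" and P: "0 < P"
  shows "(\<integral>\<^sup>+t\<in>{0<..}. enn_powr (rearrangement M f t) P \<partial>lborel)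
    \<le> (\<integral>\<^sup>+x. enn_powr (ennreal \<bar>f x\<bar>) P \<partial>M)"
proof -
  interpret M: sigma_finite_measure M by fact
  interpret MB: pair_sigma_finite M lborel ..
  let ?g = "\<lambda>x. enn_powr (ennreal \<bar>f x\<bar>) P"
  \<comment> \<open>For u > 0 this is the measure of the set where the P-th power of |f| exceeds u,
    written as an integral in preparation for the second exchange.\<close>
  define G where "G u = (\<integral>\<^sup>+x. (if 0 < u \<and> ennreal u < ?g x then 1 else 0) \<partial>M)" for u :: real
  have [measurable]: "G \<in> borel_measurable borel"
    unfolding G_def by measurable
  have G: "distribution_function M f (u powr (1 / P)) = G u" if "0 < u" for u
  proof -
    have "{x \<in> space M. u powr (1 / P) < \<bar>f x\<bar>} = {x \<in> space M. ennreal u < ?g x}"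
      using that P by (simp add: enn_powr_less_iff) (simp add: enn_powr_ennreal ennreal_less_iff)
    then have "distribution_function M f (u powr (1 / P)) = (\<integral>\<^sup>+x. indicator {x \<in> space M. ennreal u < ?g x} x \<partial>M)"
      by (simp add: distribution_function_def)
    also have "\<dots> = G u"
      unfolding G_def using that by (intro nn_integral_cong) auto
    finally show ?thesis .
  qed
  have "(\<integral>\<^sup>+t\<in>{0<..}. enn_powr (rearrangement M f t) P \<partial>lborel)
      \<le> (\<integral>\<^sup>+t. (\<integral>\<^sup>+u. (if 0 < t \<and> ennreal t < G u then 1 else 0) \<partial>lborel) \<partial>lborel)"
  proof (rule nn_integral_mono)
    fix t :: real
    show "enn_powr (rearrangement M f t) P * indicator {0<..} t
        \<le> (\<integral>\<^sup>+u. (if 0 < t \<and> ennreal t < G u then 1 else 0) \<partial>lborel)"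
    proof (cases "0 < t")
      case True
      have "enn_powr (rearrangement M f t) P
          = (\<integral>\<^sup>+u. (if 0 < u \<and> ennreal u < enn_powr (rearrangement M f t) P then 1 else 0) \<partial>lborel)"
        by (rule nn_integral_below[symmetric])
      also have "\<dots> \<le> (\<integral>\<^sup>+u. (if 0 < t \<and> ennreal t < G u then 1 else 0) \<partial>lborel)"
      proof (rule nn_integral_mono)
        fix u :: real
        have "ennreal t < G u" if "0 < u" "ennreal u < enn_powr (rearrangement M f t) P"
        proof -
          have "ennreal (u powr (1 / P)) < rearrangement M f t"
            using that P unfolding enn_powr_less_iff[OF P] by (simp add: enn_powr_ennreal)
          then show ?thesis using that less_rearrangementD[of "u powr (1 / P)" M f t] G by simp
        qed
        then show "(if 0 < u \<and> ennreal u < enn_powr (rearrangement M f t) P then 1 else 0 :: ennreal)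
            \<le> (if 0 < t \<and> ennreal t < G u then 1 else 0)"
          using True by simp
      qed
      finally show ?thesis using True by simp
    qed simp
  qed
  also have "\<dots> = (\<integral>\<^sup>+u. (\<integral>\<^sup>+t. (if 0 < t \<and> ennreal t < G u then 1 else 0) \<partial>lborel) \<partial>lborel)"
    by (rule lborel_pair.Fubini') measurable
  also have "\<dots> = (\<integral>\<^sup>+u. G u \<partial>lborel)"
    by (simp add: nn_integral_below)
  also have "\<dots> = (\<integral>\<^sup>+x. (\<integral>\<^sup>+u. (if 0 < u \<and> ennreal u < ?g x then 1 else 0) \<partial>lborel) \<partial>M)"
    unfolding G_def by (rule MB.Fubini') measurable
  also have "\<dots> = (\<integral>\<^sup>+x. ?g x \<partial>M)"
    by (simp add: nn_integral_below)
  finally show ?thesis .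
qed

section \<open>Functions of one coordinate\<close>

text \<open>Lebesgue measure has no atoms, so the measure of \<open>A \<inter> {..h}\<close> is
  continuous in h, with limits 0 and a; the intermediate value theorem applies. Half-lines keep the
  test functions Borel although A is only Lebesgue measurable.\<close>

lemma ex_lebesgue_initial_part:
  assumes A: "A \<in> sets lebesgue" "emeasure lebesgue A = ennreal a" and s: "0 < s" "s < a"
  shows "\<exists>h::real. emeasure lebesgue (A \<inter> {..h}) = ennreal s"
proof -
  define \<nu> where "\<nu> = distr (lebesgue_on A) borel (\<lambda>x. x)"
  have [measurable]: "(\<lambda>x. x) \<in> borel_measurable (lebesgue_on A)"
    by (intro measurable_restrict_space1 measurable_completion) simp
  have \<nu>: "emeasure \<nu> B = emeasure lebesgue (A \<inter> B)" if "B \<in> sets borel" for B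
    using that A(1) unfolding \<nu>_def
    by (subst emeasure_distr) (auto simp: emeasure_restrict_space Int_commute simp del: emeasure_completion)
  have space: "space \<nu> = UNIV" by (simp add: \<nu>_def)
  have "finite_measure \<nu>"
    using \<nu>[of UNIV] A by (intro finite_measureI) (simp add: space del: emeasure_completion)
  then interpret \<nu>: finite_borel_measure \<nu>
    by (intro finite_borel_measure.intro finite_borel_measure_axioms.intro) (simp_all add: \<nu>_def)
  have total: "measure \<nu> (space \<nu>) = a"
    using \<nu>[of UNIV] A s by (simp add: measure_def space del: emeasure_completion)
  have cont: "isCont (cdf \<nu>) x" for x
  proof -
    have "emeasure lebesgue (A \<inter> {x}) \<le> emeasure lebesgue {x}"
      using A by (intro emeasure_mono) auto
    then have "emeasure lebesgue (A \<inter> {x}) = 0" by simp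
    then show ?thesis
      using \<nu>[of "{x}"] by (simp add: \<nu>.isCont_cdf measure_def del: emeasure_completion)
  qed
  obtain u where u: "cdf \<nu> u < s"
    using eventually_happens[OF order_tendstoD(2)[OF \<nu>.cdf_lim_at_bot s(1)]] by auto
  obtain v where v: "s < cdf \<nu> v"
    using eventually_happens[OF order_tendstoD(1)[OF \<nu>.cdf_lim_at_top, of s]] s total by auto
  have "u \<le> v"
    using u v \<nu>.cdf_nondecreasing[of v u] by (cases "u \<le> v") auto
  then obtain h where "cdf \<nu> h = s"
    using IVT[of "cdf \<nu>" u s v] u v cont by auto
  then have "emeasure \<nu> {..h} = ennreal s"
    by (simp add: \<nu>.emeasure_eq_measure cdf_def)
  then show ?thesis using \<nu>[of "{..h}"] by (auto simp del: emeasure_completion)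
qed

lemma Lq_norm_cmult:
  assumes "0 < c" "0 < P"
  shows "Lq_norm M (ennreal P) (\<lambda>t. ennreal c * g t) = ennreal c * Lq_norm M (ennreal P) g"
  using assms
  by (simp add: Lq_norm_def enn_powr_mult enn_powr_ennreal nn_integral_cmult_pos powr_powr)

lemma ex_Lq_norm_const:
  assumes "0 < emeasure M (space M)" "emeasure M (space M) < \<infinity>" "0 < q"
  shows "\<exists>c>0. \<forall>y. Lq_norm M q (\<lambda>_. y) = ennreal c * y"
proof (cases q)
  case (real r)
  obtain m where m: "emeasure M (space M) = ennreal m" "0 < m"
    using assms(1,2) by (cases "emeasure M (space M)") auto
  show ?thesis
    using real m assms
    by (intro exI[of _ "m powr (1 / r)"])
      (auto simp: Lq_norm_def enn_powr_mult enn_powr_powr enn_powr_ennreal mult.commute)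
next
  case top
  then show ?thesis using assms by (intro exI[of _ 1]) (simp add: Lq_norm_def esssup_const)
qed

context
  fixes d :: nat and \<Omega> :: "nat \<Rightarrow> real set" and p :: "nat \<Rightarrow> ennreal" and j :: nat and P :: real
  assumes \<Omega>: "\<And>i. i \<in> {1..d} \<Longrightarrow> \<Omega> i \<in> sets lebesgue"
    and pos: "\<And>i. i \<in> {1..d} \<Longrightarrow> 0 < emeasure lebesgue (\<Omega> i)"
    and fin: "\<And>i. i \<in> {1..d} \<Longrightarrow> emeasure lebesgue (\<Omega> i) < \<infinity>"
    and p: "\<And>i. i \<in> {1..d} \<Longrightarrow> 0 < p i"
    and j: "j \<in> {1..d}" and P: "p j = ennreal P" "0 < P"
begin

text \<open>In every variable other than the j-th the iterate is constant, which contributes a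
  positive finite factor. The case distinction records whether the j-th variable has already been
  integrated out.\<close>

lemma mixed_iter_cylinder:
  assumes "k \<le> d"
  shows "\<exists>K>0. \<forall>g x. mixed_iter \<Omega> p (\<lambda>x. g (x j)) k x = ennreal K *
    (if k < j then ennreal \<bar>g (x j)\<bar> else Lq_norm (lebesgue_on (\<Omega> j)) (p j) (\<lambda>t. ennreal \<bar>g t\<bar>))"
  using assms
proof (induction k)
  case 0
  then show ?case using j by (intro exI[of _ 1]) auto
next
  case (Suc k)
  then obtain K where K: "0 < K" "\<And>g x. mixed_iter \<Omega> p (\<lambda>x. g (x j)) k x = ennreal K *
    (if k < j then ennreal \<bar>g (x j)\<bar> else Lq_norm (lebesgue_on (\<Omega> j)) (p j) (\<lambda>t. ennreal \<bar>g t\<bar>))"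
    by auto
  show ?case
  proof (cases "Suc k = j")
    case True
    then show ?thesis
      using K P by (intro exI[of _ K]) (auto simp: Lq_norm_cmult)
  next
    case False
    have i: "Suc k \<in> {1..d}" using Suc.prems by auto
    have "emeasure (lebesgue_on (\<Omega> (Suc k))) (space (lebesgue_on (\<Omega> (Suc k)))) = emeasure lebesgue (\<Omega> (Suc k))"
      using \<Omega>[OF i] by (simp add: emeasure_restrict_space del: emeasure_completion)
    then obtain c where c: "0 < c" "\<And>y. Lq_norm (lebesgue_on (\<Omega> (Suc k))) (p (Suc k)) (\<lambda>_. y) = ennreal c * y"
      using ex_Lq_norm_const[of "lebesgue_on (\<Omega> (Suc k))" "p (Suc k)"] pos[OF i] fin[OF i] p[OF i] by metis
    have "k < j \<longleftrightarrow> Suc k < j" using False by auto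
    then show ?thesis
      using K c False by (intro exI[of _ "c * K"]) (auto simp: ennreal_mult' mult.assoc)
  qed
qed

lemma mixed_norm_cylinder:
  "\<exists>K>0. \<forall>g. mixed_norm d \<Omega> p (\<lambda>x. g (x j)) =
    ennreal K * Lq_norm (lebesgue_on (\<Omega> j)) (p j) (\<lambda>t. ennreal \<bar>g t\<bar>)"
  using mixed_iter_cylinder[OF order_refl] j by (auto simp: mixed_norm_def)

lemma measurable_cylinder:
  fixes g :: "real \<Rightarrow> real"
  assumes [measurable]: "g \<in> borel_measurable borel"
  shows "(\<lambda>x. g (x j)) \<in> borel_measurable (prod_lebesgue_on d \<Omega>)"
  unfolding prod_lebesgue_on_def
  using j by (intro measurable_restrict_space1 measurable_completion) measurable

text \<open>The cylinder is the box with \<Omega> j replaced by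
  \<open>\<Omega> j \<inter> B\<close>, so R is the product of the measures of the other
  factors.\<close>

lemma emeasure_cylinder:
  "\<exists>R>0. \<forall>B \<in> sets borel. emeasure (prod_lebesgue_on d \<Omega>) {x \<in> space (prod_lebesgue_on d \<Omega>). x j \<in> B}
    = ennreal R * emeasure lebesgue (\<Omega> j \<inter> B)"
proof -
  define R where "R = (\<Prod>i\<in>{1..d} - {j}. enn2real (emeasure lebesgue (\<Omega> i)))"
  have R: "ennreal R = (\<Prod>i\<in>{1..d} - {j}. emeasure lebesgue (\<Omega> i))"
    using fin unfolding R_def
    by (subst prod_ennreal[symmetric]) (auto intro!: prod.cong simp del: emeasure_completion)
  have "0 < R"
    unfolding R_def using pos fin by (intro prod_pos) (auto simp: enn2real_positive_iff simp del: emeasure_completion)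
  moreover have "emeasure (prod_lebesgue_on d \<Omega>) {x \<in> space (prod_lebesgue_on d \<Omega>). x j \<in> B}
    = ennreal R * emeasure lebesgue (\<Omega> j \<inter> B)" if B: "B \<in> sets borel" for B
  proof -
    let ?A = "\<lambda>i. if i = j then \<Omega> j \<inter> B else \<Omega> i"
    have A: "?A i \<in> sets lebesgue" if "i \<in> {1..d}" for i
      using that \<Omega> B by auto
    have box: "Pi\<^sub>E {1..d} \<Omega> \<in> sets (completion (Pi\<^sub>M {1..d} (\<lambda>_. lborel)))"
      using \<Omega> by (intro sets_completion_PiE_lebesgue) auto
    have eq: "{x \<in> space (prod_lebesgue_on d \<Omega>). x j \<in> B} = Pi\<^sub>E {1..d} ?A"
    proof (intro set_eqI iffI)
      fix x assume "x \<in> Pi\<^sub>E {1..d} ?A"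
      then have x: "x \<in> extensional {1..d}" "x i \<in> ?A i" if "i \<in> {1..d}" for i
        using that by (auto simp: PiE_iff)
      then have "x i \<in> \<Omega> i" if "i \<in> {1..d}" for i
        using x(2)[OF that] by (cases "i = j") auto
      then show "x \<in> {x \<in> space (prod_lebesgue_on d \<Omega>). x j \<in> B}"
        using x j x(2)[OF j] unfolding space_prod_lebesgue_on by (auto simp: PiE_iff)
    qed (use j in \<open>auto simp: space_prod_lebesgue_on PiE_iff\<close>)
    have sub: "Pi\<^sub>E {1..d} ?A \<subseteq> Pi\<^sub>E {1..d} \<Omega>"
      by (intro PiE_mono) auto
    have "emeasure (prod_lebesgue_on d \<Omega>) {x \<in> space (prod_lebesgue_on d \<Omega>). x j \<in> B}
        = emeasure (completion (Pi\<^sub>M {1..d} (\<lambda>_. lborel))) (Pi\<^sub>E {1..d} ?A)"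
      unfolding eq unfolding prod_lebesgue_on_def using box sub
      by (intro emeasure_restrict_space) (simp_all only: sets.Int_space_eq2)
    also have "\<dots> = (\<Prod>i\<in>{1..d}. emeasure lebesgue (?A i))"
      using A by (intro emeasure_completion_PiE_lebesgue) auto
    also have "\<dots> = emeasure lebesgue (\<Omega> j \<inter> B) * (\<Prod>i\<in>{1..d} - {j}. emeasure lebesgue (?A i))"
      using j by (subst prod.remove[of _ j]) (auto simp del: emeasure_completion)
    also have "(\<Prod>i\<in>{1..d} - {j}. emeasure lebesgue (?A i)) = ennreal R"
      unfolding R by (intro prod.cong) auto
    finally show ?thesis by (simp add: mult.commute del: emeasure_completion)
  qed
  ultimately show ?thesis by blast
qed

text \<open>The P-th power of f is the sum of the w k times the indicators of x j \<le> h k, where h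
  k cuts a part of measure s k off \<Omega> j. Summing inside the P-th root makes the quasi-norm
  explicit for every P. K and R are fixed before n, w and s, as the later limit in n
  demands.\<close>

lemma ex_staircase:
  assumes a: "emeasure lebesgue (\<Omega> j) = ennreal a"
  shows "\<exists>K>0. \<exists>R>0. \<forall>(n::nat) w s. (\<forall>k\<le>n. 0 \<le> w k \<and> 0 < s k \<and> s k < a) \<longrightarrow>
    (\<exists>f \<in> borel_measurable (prod_lebesgue_on d \<Omega>).
      mixed_norm d \<Omega> p f = ennreal (K * (\<Sum>k\<le>n. w k * s k) powr (1 / P)) \<and>
      (\<forall>k\<le>n. \<forall>t. t < R * s k \<longrightarrow>
        ennreal (w k powr (1 / P)) \<le> rearrangement (prod_lebesgue_on d \<Omega>) f t))"
proof -
  obtain K where K: "0 < K" "\<And>g. mixed_norm d \<Omega> p (\<lambda>x. g (x j)) =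
    ennreal K * Lq_norm (lebesgue_on (\<Omega> j)) (p j) (\<lambda>t. ennreal \<bar>g t\<bar>)"
    using mixed_norm_cylinder by auto
  obtain R where R: "0 < R" "\<And>B. B \<in> sets borel \<Longrightarrow>
    emeasure (prod_lebesgue_on d \<Omega>) {x \<in> space (prod_lebesgue_on d \<Omega>). x j \<in> B}
    = ennreal R * emeasure lebesgue (\<Omega> j \<inter> B)"
    using emeasure_cylinder by auto
  let ?M = "prod_lebesgue_on d \<Omega>" and ?L = "lebesgue_on (\<Omega> j)"
  have "\<exists>f \<in> borel_measurable ?M.
      mixed_norm d \<Omega> p f = ennreal (K * (\<Sum>k\<le>n. w k * s k) powr (1 / P)) \<and>
      (\<forall>k\<le>n. \<forall>t. t < R * s k \<longrightarrow> ennreal (w k powr (1 / P)) \<le> rearrangement ?M f t)"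
    if ws: "\<And>k. k \<le> n \<Longrightarrow> 0 \<le> w k \<and> 0 < s k \<and> s k < a" for n :: nat and w s
  proof -
    have "\<forall>k\<in>{..n}. \<exists>h. emeasure lebesgue (\<Omega> j \<inter> {..h}) = ennreal (s k)"
      using ex_lebesgue_initial_part[OF \<Omega>[OF j] a] ws by blast
    from bchoice[OF this]
    obtain h where h: "\<And>k. k \<le> n \<Longrightarrow> emeasure lebesgue (\<Omega> j \<inter> {..h k}) = ennreal (s k)"
      by blast
    define G where "G t = (\<Sum>k\<le>n. w k * indicator {..h k} t)" for t :: real
    define g where "g t = G t powr (1 / P)" for t
    have G0: "0 \<le> G t" for t unfolding G_def using ws by (intro sum_nonneg) auto
    have [measurable]: "G \<in> borel_measurable borel" unfolding G_def by measurable
    have [measurable]: "g \<in> borel_measurable borel" unfolding g_def by measurable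
    have f[measurable]: "(\<lambda>x. g (x j)) \<in> borel_measurable ?M"
      by (rule measurable_cylinder) measurable
    have level: "\<Omega> j \<inter> {..h k} \<in> sets ?L" "emeasure ?L (\<Omega> j \<inter> {..h k}) = ennreal (s k)" if "k \<le> n" for k
      using \<Omega>[OF j] h[OF that]
      by (auto simp: sets_restrict_space emeasure_restrict_space simp del: emeasure_completion)
    have "(\<integral>\<^sup>+t. enn_powr (ennreal \<bar>g t\<bar>) P \<partial>?L) = (\<integral>\<^sup>+t. (\<Sum>k\<le>n. ennreal (w k) * indicator (\<Omega> j \<inter> {..h k}) t) \<partial>?L)"
    proof (rule nn_integral_cong)
      fix t assume t: "t \<in> space ?L"
      have "enn_powr (ennreal \<bar>g t\<bar>) P = ennreal (G t)"
        using P G0[of t] by (simp add: enn_powr_ennreal g_def powr_powr)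
      also have "\<dots> = (\<Sum>k\<le>n. ennreal (w k * indicator {..h k} t))"
        unfolding G_def using ws by (intro sum_ennreal[symmetric]) auto
      also have "\<dots> = (\<Sum>k\<le>n. ennreal (w k) * indicator (\<Omega> j \<inter> {..h k}) t)"
        using ws t by (intro sum.cong) (auto simp: indicator_def)
      finally show "enn_powr (ennreal \<bar>g t\<bar>) P = (\<Sum>k\<le>n. ennreal (w k) * indicator (\<Omega> j \<inter> {..h k}) t)" .
    qed
    also have "\<dots> = (\<Sum>k\<le>n. ennreal (w k) * ennreal (s k))"
    proof (subst nn_integral_sum)
      show "(\<Sum>k\<le>n. \<integral>\<^sup>+t. ennreal (w k) * indicator (\<Omega> j \<inter> {..h k}) t \<partial>?L)
          = (\<Sum>k\<le>n. ennreal (w k) * ennreal (s k))"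
        using level by (intro sum.cong refl) (simp del: emeasure_completion
          add: nn_integral_cmult_indicator)
    qed (use level(1) in \<open>intro borel_measurable_times_ennreal borel_measurable_const
          borel_measurable_indicator; simp\<close>)
    also have "\<dots> = ennreal (\<Sum>k\<le>n. w k * s k)"
      using ws by (subst sum_ennreal[symmetric])
        (auto simp: ennreal_mult less_imp_le intro!: sum.cong mult_nonneg_nonneg)
    finally have I: "(\<integral>\<^sup>+t. enn_powr (ennreal \<bar>g t\<bar>) P \<partial>?L) = ennreal (\<Sum>k\<le>n. w k * s k)" .
    have "0 \<le> (\<Sum>k\<le>n. w k * s k)"
      using ws by (intro sum_nonneg) (auto simp: less_imp_le)
    then have "mixed_norm d \<Omega> p (\<lambda>x. g (x j)) = ennreal (K * (\<Sum>k\<le>n. w k * s k) powr (1 / P))"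
      using P K(1) I by (simp add: K(2) Lq_norm_def enn_powr_ennreal ennreal_mult')
    moreover have "ennreal (w k powr (1 / P)) \<le> rearrangement ?M (\<lambda>x. g (x j)) t"
      if k: "k \<le> n" and t: "t < R * s k" for k t
    proof (rule rearrangement_ge[OF f])
      have "w k powr (1 / P) \<le> g u" if "u \<le> h k" for u
      proof -
        have "w k * indicator {..h k} u \<le> G u"
          unfolding G_def using ws k by (intro member_le_sum) auto
        then show ?thesis
          using that P ws[OF k] unfolding g_def by (intro powr_mono2) auto
      qed
      then have sub: "{x \<in> space ?M. x j \<in> {..h k}} \<subseteq> {x \<in> space ?M. w k powr (1 / P) \<le> \<bar>g (x j)\<bar>}"
        by (auto intro: order_trans[OF _ abs_ge_self])
      have "ennreal t < ennreal R * ennreal (s k)"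
        using t R(1) ws[OF k] by (simp add: ennreal_mult'[symmetric] ennreal_lessI)
      also have "\<dots> = emeasure ?M {x \<in> space ?M. x j \<in> {..h k}}"
        by (subst R(2)) (auto simp: h[OF k] simp del: emeasure_completion)
      also have "\<dots> \<le> emeasure ?M {x \<in> space ?M. w k powr (1 / P) \<le> \<bar>g (x j)\<bar>}"
        by (intro emeasure_mono sub) measurable
      finally show "ennreal t < emeasure ?M {x \<in> space ?M. w k powr (1 / P) \<le> \<bar>g (x j)\<bar>}" .
    qed
    ultimately show ?thesis using f by blast
  qed
  then show ?thesis using K(1) R(1) by blast
qed

end

section \<open>The envelope functional for power weights\<close>

text \<open>Passes from the finite measure of a box to its factors. Positivity is carried through
  the induction because a zero factor would hide an infinite one.\<close>

lemma ennreal_prod_pos_finite: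
  fixes f :: "'i \<Rightarrow> ennreal"
  assumes "finite I" "\<And>i. i \<in> I \<Longrightarrow> 0 < f i"
  shows "0 < prod f I \<and> (prod f I < top \<longrightarrow> (\<forall>i\<in>I. f i < top))"
  using assms
proof (induction I)
  case (insert i I)
  have "0 < f i" by (rule insert.prems) simp
  moreover have "0 < prod f I \<and> (prod f I < top \<longrightarrow> (\<forall>i\<in>I. f i < top))"
    by (intro insert.IH insert.prems) simp
  ultimately show ?case
    using insert.hyps unfolding prod.insert[OF insert.hyps]
    by (simp only: ennreal_zero_less_mult_iff ennreal_mult_less_top) (auto simp only: less_irrefl)
qed simp

lemma has_real_derivative_powr_neg:
  fixes t P :: real
  shows "0 < t \<Longrightarrow> ((\<lambda>t. t powr (-1 / P)) has_real_derivative - (t powr (-1 / P - 1) / P)) (at t)"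
  by (auto intro!: derivative_eq_intros)

lemma deriv_powr_neg:
  fixes t P :: real
  shows "0 < t \<Longrightarrow> deriv (\<lambda>t. t powr (-1 / P)) t = - (t powr (-1 / P - 1) / P)"
  by (rule DERIV_imp_deriv[OF has_real_derivative_powr_neg])

text \<open>For this \<Psi> the weight is 1 / (P t), and dividing by \<Psi> contributes
  \<open>t powr (V / P)\<close> after taking the V-th power.\<close>

lemma envelope_functional_powr:
  assumes P: "0 < P" and V: "0 < V"
  shows "envelope_functional M (\<lambda>t. t powr (-1 / P)) \<epsilon> (ennreal V) f =
    enn_powr (\<integral>\<^sup>+t\<in>{0<..<\<epsilon>}. ennreal (t powr (V / P - 1) / P) * enn_powr (rearrangement M f t) V \<partial>lborel) (1 / V)"
proof -
  have "enn_powr (rearrangement M f t / ennreal (t powr (-1 / P))) V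
      * ennreal (- (deriv (\<lambda>t. t powr (-1 / P)) t / t powr (-1 / P)))
      = ennreal (t powr (V / P - 1) / P) * enn_powr (rearrangement M f t) V" if t: "0 < t" for t
  proof -
    have "rearrangement M f t / ennreal (t powr (-1 / P)) = ennreal (t powr (1 / P)) * rearrangement M f t"
      using t by (simp add: divide_ennreal_def inverse_ennreal powr_minus mult.commute)
    then have 1: "enn_powr (rearrangement M f t / ennreal (t powr (-1 / P))) V
        = ennreal (t powr (V / P)) * enn_powr (rearrangement M f t) V"
      using V by (simp add: enn_powr_mult enn_powr_ennreal powr_powr)
    have 2: "- (deriv (\<lambda>t. t powr (-1 / P)) t / t powr (-1 / P)) = t powr (-1) / P"
      using t unfolding deriv_powr_neg[OF t] by (simp add: powr_diff powr_minus field_simps)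
    have "t powr (V / P) * (t powr (-1) / P) = t powr (V / P - 1) / P"
      by (simp add: powr_diff powr_minus field_simps)
    then show ?thesis
      unfolding 1 2 using P t
      by (simp add: ennreal_mult'[symmetric] mult.assoc mult.left_commute mult.commute)
  qed
  then show ?thesis
    using V unfolding envelope_functional_def
    by (auto intro!: arg_cong2[where f = enn_powr] nn_integral_cong simp: indicator_def)
qed

text \<open>Selects for each t the step of the dyadic staircase that bounds the rearrangement
  there.\<close>

lemma dyadic_interval:
  fixes b t :: real
  assumes "b / 2 ^ Suc n \<le> t" "t < b"
  shows "\<exists>k\<le>n. b / 2 ^ Suc k \<le> t \<and> t < b / 2 ^ k"
  using assms
proof (induction n)
  case (Suc n)
  show ?case
  proof (cases "t < b / 2 ^ Suc n")
    case True
    then show ?thesis using Suc.prems by blast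
  next
    case False
    then show ?thesis using Suc by (metis le_SucI not_le)
  qed
qed simp

lemma nn_integral_inverse_Icc:
  fixes u v :: real
  assumes "0 < u" "u \<le> v"
  shows "(\<integral>\<^sup>+t\<in>{u..v}. ennreal (1 / t) \<partial>lborel) = ennreal (ln v - ln u)"
  using assms by (intro nn_integral_FTC_Icc) (auto intro!: derivative_eq_intros)

text \<open>The rearrangement decreases, so t times its P-th power at t is at most the integral of
  that power over (0, t).\<close>

lemma rearrangement_powr_le:
  assumes t: "0 < t" and C: "0 \<le> C" and P: "0 < P"
    and I: "(\<integral>\<^sup>+t\<in>{0<..}. enn_powr (rearrangement M f t) P \<partial>lborel) \<le> ennreal C"
  shows "rearrangement M f t \<le> ennreal (C powr (1 / P) * t powr (-1 / P))"
proof -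
  let ?y = "enn_powr (rearrangement M f t) P"
  have "?y * ennreal t = (\<integral>\<^sup>+\<tau>. ?y * indicator {0<..<t} \<tau> \<partial>lborel)"
    using t by (simp add: nn_integral_cmult_indicator)
  also have "\<dots> \<le> (\<integral>\<^sup>+t\<in>{0<..}. enn_powr (rearrangement M f t) P \<partial>lborel)"
    using P by (intro nn_integral_mono)
      (auto simp: indicator_def intro!: enn_powr_mono rearrangement_antimono)
  also note I
  finally have "?y * ennreal t * ennreal (1 / t) \<le> ennreal C * ennreal (1 / t)"
    by (rule mult_right_mono) simp
  then have "?y \<le> ennreal (C / t)"
    using t C by (simp add: mult.assoc ennreal_mult'[symmetric])
  then have "rearrangement M f t \<le> enn_powr (ennreal (C / t)) (1 / P)"
    using P by (simp add: enn_powr_le_iff)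
  also have "\<dots> = ennreal (C powr (1 / P) * t powr (-1 / P))"
    using t C by (simp add: enn_powr_ennreal powr_divide powr_minus) (simp add: divide_inverse)
  finally show ?thesis .
qed

text \<open>At V = P the power of t in \<open>envelope_functional_powr\<close> disappears, leaving
  the integral of the P-th power of the rearrangement divided by P.\<close>

lemma envelope_functional_le:
  assumes P: "0 < P" and C: "0 \<le> C"
    and I: "(\<integral>\<^sup>+t\<in>{0<..}. enn_powr (rearrangement M f t) P \<partial>lborel) \<le> ennreal C * enn_powr y P"
  shows "envelope_functional M (\<lambda>t. t powr (-1 / P)) \<epsilon> (ennreal P) f \<le> ennreal ((C / P) powr (1 / P)) * y"
proof -
  have "(\<integral>\<^sup>+t\<in>{0<..<\<epsilon>}. ennreal (t powr (P / P - 1) / P) * enn_powr (rearrangement M f t) P \<partial>lborel)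
      \<le> (\<integral>\<^sup>+t. ennreal (1 / P) * (enn_powr (rearrangement M f t) P * indicator {0<..} t) \<partial>lborel)"
    using P by (intro nn_integral_mono) (auto simp: indicator_def)
  also have "\<dots> = ennreal (1 / P) * (\<integral>\<^sup>+t\<in>{0<..}. enn_powr (rearrangement M f t) P \<partial>lborel)"
    using P by (intro nn_integral_cmult_pos) simp
  also have "\<dots> \<le> ennreal (1 / P) * (ennreal C * enn_powr y P)"
    by (intro mult_left_mono I) simp
  also have "\<dots> = ennreal (C / P) * enn_powr y P"
    using P C by (simp add: mult.assoc[symmetric] ennreal_mult'[symmetric])
  finally have "envelope_functional M (\<lambda>t. t powr (-1 / P)) \<epsilon> (ennreal P) f
      \<le> enn_powr (ennreal (C / P) * enn_powr y P) (1 / P)"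
    unfolding envelope_functional_powr[OF P P] using P by (intro enn_powr_mono) auto
  also have "\<dots> = ennreal ((C / P) powr (1 / P)) * y"
    using P C by (simp add: enn_powr_mult enn_powr_powr enn_powr_ennreal)
  finally show ?thesis .
qed

text \<open>On the k-th dyadic interval 2^k is at least b / (2 t), so the integrand is at least a
  constant over t; integrating 1 / t from b / 2^(n+1) to \<beta> gives the logarithms. Stopping at
  \<beta> < \<epsilon> costs only a term independent of n.\<close>

lemma envelope_functional_ge:
  assumes P: "0 < P" and V: "0 < V" and b: "0 < b" and \<beta>: "b / 2 ^ Suc n \<le> \<beta>" "\<beta> < b" "\<beta> < \<epsilon>"
    and f: "\<And>k t. k \<le> n \<Longrightarrow> t < b / 2 ^ k \<Longrightarrow> ennreal ((2 ^ k) powr (1 / P)) \<le> rearrangement M f t"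
  shows "ennreal ((b / 2) powr (V / P) / P * (real (Suc n) * ln 2 + ln (\<beta> / b)))
    \<le> enn_powr (envelope_functional M (\<lambda>t. t powr (-1 / P)) \<epsilon> (ennreal V) f) V"
proof -
  let ?u = "b / 2 ^ Suc n"
  let ?\<kappa> = "(b / 2) powr (V / P) / P"
  have u: "0 < ?u" using b by simp
  have pt: "ennreal ?\<kappa> * ennreal (1 / t)
      \<le> ennreal (t powr (V / P - 1) / P) * enn_powr (rearrangement M f t) V" if t: "?u \<le> t" "t \<le> \<beta>" for t
  proof -
    have t0: "0 < t" using t u by simp
    obtain k where k: "k \<le> n" "b / 2 ^ Suc k \<le> t" "t < b / 2 ^ k"
      using dyadic_interval[of b n t] t \<beta> by auto
    have "b / 2 \<le> t * 2 ^ k" using k(2) by (simp add: field_simps)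
    then have "(b / 2) powr (V / P) \<le> (t * 2 ^ k) powr (V / P)"
      using b P V by (intro powr_mono2) auto
    also have "\<dots> = t powr (V / P) * ((2 ^ k) powr (1 / P)) powr V"
      using t0 by (simp add: powr_mult powr_powr)
    finally have "?\<kappa> * (1 / t) \<le> t powr (V / P) * ((2 ^ k) powr (1 / P)) powr V / P * (1 / t)"
      using P t0 by (intro mult_right_mono divide_right_mono) auto
    also have "\<dots> = t powr (V / P - 1) / P * ((2 ^ k) powr (1 / P)) powr V"
      using t0 by (simp add: powr_diff)
    finally have "ennreal ?\<kappa> * ennreal (1 / t) \<le> ennreal (t powr (V / P - 1) / P * ((2 ^ k) powr (1 / P)) powr V)"
      using P t0 by (simp add: ennreal_mult'[symmetric] ennreal_leI del: times_divide_eq_right)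
    also have "\<dots> = ennreal (t powr (V / P - 1) / P) * enn_powr (ennreal ((2 ^ k) powr (1 / P))) V"
      using P t0 by (subst ennreal_mult) (auto simp: enn_powr_ennreal)
    also have "\<dots> \<le> ennreal (t powr (V / P - 1) / P) * enn_powr (rearrangement M f t) V"
      using V by (intro mult_left_mono enn_powr_mono f k) auto
    finally show ?thesis .
  qed
  have "ln \<beta> - ln ?u = real (Suc n) * ln 2 + ln (\<beta> / b)"
    using b u \<beta> by (simp add: ln_div ln_mult ln_realpow algebra_simps)
  then have "ennreal (?\<kappa> * (real (Suc n) * ln 2 + ln (\<beta> / b)))
      = ennreal ?\<kappa> * (\<integral>\<^sup>+t\<in>{?u..\<beta>}. ennreal (1 / t) \<partial>lborel)"
    unfolding nn_integral_inverse_Icc[OF u \<beta>(1)] using P by (subst ennreal_mult') auto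
  also have "\<dots> = (\<integral>\<^sup>+t. ennreal ?\<kappa> * (ennreal (1 / t) * indicator {?u..\<beta>} t) \<partial>lborel)"
    by (rule nn_integral_cmult[symmetric]) measurable
  also have "\<dots> \<le> (\<integral>\<^sup>+t\<in>{0<..<\<epsilon>}. ennreal (t powr (V / P - 1) / P) * enn_powr (rearrangement M f t) V \<partial>lborel)"
    using pt u \<beta> by (intro nn_integral_mono) (auto simp: indicator_def)
  finally show ?thesis
    unfolding envelope_functional_powr[OF P V] using V by (simp add: enn_powr_powr)
qed

text \<open>After division by n + 1 the left side tends to \<alpha> ln 2 > 0 and the right side to
  0.\<close>

lemma no_sublinear_bound:
  fixes \<alpha> \<gamma> L \<theta> :: real
  assumes "0 < \<alpha>" "\<theta> < 1" "\<forall>\<^sub>F n in sequentially. \<alpha> * (real (Suc n) * ln 2 + L) \<le> \<gamma> * real (Suc n) powr \<theta>"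
  shows False
proof -
  have "(\<lambda>n. (real (Suc n) * ln 2 + L) / real (Suc n)) \<longlonglongrightarrow> ln 2" by real_asymp
  then have 1: "(\<lambda>n. \<alpha> * ((real (Suc n) * ln 2 + L) / real (Suc n))) \<longlonglongrightarrow> \<alpha> * ln 2"
    by (intro tendsto_intros)
  have "(\<lambda>n. real (Suc n) powr (\<theta> - 1)) \<longlonglongrightarrow> 0" using assms(2) by real_asymp
  then have 2: "(\<lambda>n. \<gamma> * real (Suc n) powr (\<theta> - 1)) \<longlonglongrightarrow> \<gamma> * 0"
    by (intro tendsto_intros)
  have "\<forall>\<^sub>F n in sequentially. \<alpha> * ((real (Suc n) * ln 2 + L) / real (Suc n)) \<le> \<gamma> * real (Suc n) powr (\<theta> - 1)"
    using assms(3) by eventually_elim (simp add: powr_diff divide_right_mono del: of_nat_Suc)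
  then have "\<alpha> * ln 2 \<le> \<gamma> * 0" by (rule tendsto_le[OF _ 2 1, rotated]) simp
  then show False using assms(1) by (simp add: mult_le_0_iff)
qed

section \<open>The growth envelope\<close>

theorem corollary3p7:
  fixes d :: nat and \<Omega> :: "nat \<Rightarrow> real set" and p :: "nat \<Rightarrow> ennreal"
  assumes "1 \<le> d"
    and "\<And>i. i \<in> {1..d} \<Longrightarrow> \<Omega> i \<in> sets lebesgue"
    and "\<And>i. i \<in> {1..d} \<Longrightarrow> 0 < emeasure lebesgue (\<Omega> i)"
    and "emeasure (prod_lebesgue_on d \<Omega>) (Pi\<^sub>E {1..d} \<Omega>) < \<infinity>"
    and "\<And>i. i \<in> {1..d} \<Longrightarrow> 0 < p i"
    and "Min (p ` {1..d}) < \<infinity>"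
  shows "has_growth_envelope (prod_lebesgue_on d \<Omega>) (mixed_Lp d \<Omega> p) (mixed_norm d \<Omega> p)
           (\<lambda>t. t powr (- 1 / enn2real (Min (p ` {1..d}))), Min (p ` {1..d}))"
proof -
  let ?M = "prod_lebesgue_on d \<Omega>" and ?X = "mixed_Lp d \<Omega> p" and ?N = "mixed_norm d \<Omega> p"
  define P where "P = enn2real (Min (p ` {1..d}))"
  let ?\<Psi> = "\<lambda>t::real. t powr (- 1 / P)"
  have "Min (p ` {1..d}) \<in> p ` {1..d}" using assms(1) by (intro Min_in) auto
  then obtain j where j: "j \<in> {1..d}" "p j = Min (p ` {1..d})" by auto
  have P: "Min (p ` {1..d}) = ennreal P" "0 < P"
    using assms(5)[OF j(1)] assms(6) unfolding j(2) P_def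
    by (auto simp: enn2real_positive_iff)
  have pj: "p j = ennreal P" using j(2) P(1) by simp
  have Pmin: "ennreal P \<le> p i" if "i \<in> {1..d}" for i
    using that unfolding P(1)[symmetric] by (intro Min_le) auto

  have box: "Pi\<^sub>E {1..d} \<Omega> \<in> sets (completion (Pi\<^sub>M {1..d} (\<lambda>_. lborel)))"
    using assms(2) by (intro sets_completion_PiE_lebesgue) auto
  have "emeasure ?M (Pi\<^sub>E {1..d} \<Omega>)
      = emeasure (completion (Pi\<^sub>M {1..d} (\<lambda>_. lborel))) (Pi\<^sub>E {1..d} \<Omega>)"
    unfolding prod_lebesgue_on_def using box
    by (intro emeasure_restrict_space) (simp_all only: sets.Int_space_eq2 order_refl)
  also have "\<dots> = (\<Prod>i\<in>{1..d}. emeasure lebesgue (\<Omega> i))"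
    using assms(2) by (intro emeasure_completion_PiE_lebesgue) auto
  finally have fin: "emeasure lebesgue (\<Omega> i) < \<infinity>" if "i \<in> {1..d}" for i
    using ennreal_prod_pos_finite[of "{1..d}" "\<lambda>i. emeasure lebesgue (\<Omega> i)"] assms(3,4) that
    by (simp del: emeasure_completion)
  interpret finite_measure ?M
    using assms(4) by (intro finite_measureI) (simp add: space_prod_lebesgue_on)

  \<comment> \<open>Integral bound for rearrangements\<close>
  have "\<exists>C>0. \<forall>f::(nat \<Rightarrow> real) \<Rightarrow> real. f \<in> borel_measurable ?M \<longrightarrow>
      (\<integral>\<^sup>+x. enn_powr (ennreal \<bar>f x\<bar>) P \<partial>?M) \<le> ennreal C * enn_powr (?N f) P"
    by (rule nn_integral_powr_le_mixed_norm[OF assms(2) fin box P(2) Pmin])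
  then obtain C where C: "0 < C" "\<And>f. f \<in> borel_measurable ?M \<Longrightarrow>
      (\<integral>\<^sup>+x. enn_powr (ennreal \<bar>f x\<bar>) P \<partial>?M) \<le> ennreal C * enn_powr (?N f) P"
    by blast
  have upper: "(\<integral>\<^sup>+t\<in>{0<..}. enn_powr (rearrangement ?M f t) P \<partial>lborel) \<le> ennreal C * enn_powr (?N f) P"
    if "f \<in> ?X" for f
    using that nn_integral_rearrangement_powr_le[OF sigma_finite_measure_axioms _ P(2), of f] C(2)[of f]
    by (auto simp: mixed_Lp_def)

  obtain a where a: "emeasure lebesgue (\<Omega> j) = ennreal a" "0 < a"
    using fin[OF j(1)] assms(3)[OF j(1)] by (cases "emeasure lebesgue (\<Omega> j)") auto
  obtain K R where KR: "0 < K" "0 < R"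
    and stair: "\<And>(n::nat) w s. (\<And>k. k \<le> n \<Longrightarrow> 0 \<le> w k \<and> 0 < s k \<and> s k < a) \<Longrightarrow>
      (\<exists>f \<in> borel_measurable ?M. ?N f = ennreal (K * (\<Sum>k\<le>n. w k * s k) powr (1 / P)) \<and>
      (\<forall>k\<le>n. \<forall>t. t < R * s k \<longrightarrow> ennreal (w k powr (1 / P)) \<le> rearrangement ?M f t))"
    using ex_staircase[where d = d and \<Omega> = \<Omega> and p = p and j = j,
        OF assms(2,3) fin assms(5) j(1) pj P(2) a(1)] by blast

  \<comment> \<open>Two-sided bounds of the envelope function\<close>
  have growth_le: "growth_envelope_function ?M ?X ?N t \<le> ennreal (C powr (1 / P) * ?\<Psi> t)"
    if t: "0 < t" for t
    unfolding growth_envelope_function_def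
  proof (rule SUP_least)
    fix f assume f: "f \<in> {f \<in> ?X. ?N f \<le> 1}"
    have "ennreal C * enn_powr (?N f) P \<le> ennreal C * enn_powr 1 P"
      using f P(2) by (intro mult_left_mono enn_powr_mono) auto
    then have "(\<integral>\<^sup>+t\<in>{0<..}. enn_powr (rearrangement ?M f t) P \<partial>lborel) \<le> ennreal C"
      using upper[of f] f by auto
    then show "rearrangement ?M f t \<le> ennreal (C powr (1 / P) * ?\<Psi> t)"
      using C(1) by (intro rearrangement_powr_le t P) auto
  qed
  define A where "A = (R / 2) powr (1 / P) / K"
  have growth_ge: "ennreal (A * ?\<Psi> t) \<le> growth_envelope_function ?M ?X ?N t"
    if t: "0 < t" "t < R * a / 2" for t
  proof -
    \<comment> \<open>A staircase with one step. Here R s = 2 t exceeds t, so the lower bound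
      reaches t, and s < a amounts to t < R a / 2; w normalises the quasi-norm to 1. The resulting
      value \<open>w powr (1 / P)\<close> dictates the constant A.\<close>
    define s where "s = 2 * t / R"
    define w where "w = 1 / (K powr P * s)"
    have s: "0 < s" "s < a" and ts: "t < R * s"
      using t KR by (auto simp: s_def field_simps)
    obtain f where f: "f \<in> borel_measurable ?M" "?N f = ennreal (K * (w * s) powr (1 / P))"
      "\<And>t. t < R * s \<Longrightarrow> ennreal (w powr (1 / P)) \<le> rearrangement ?M f t"
      using stair[of 0 "\<lambda>_. w" "\<lambda>_. s"] s KR by (auto simp: w_def)
    have "(w * s) powr (1 / P) = 1 / K"
      using s KR P(2) by (simp add: w_def powr_divide powr_powr)
    then have "?N f = 1" using f(2) KR by simp
    then have "f \<in> {f \<in> ?X. ?N f \<le> 1}" using f(1) by (simp add: mixed_Lp_def)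
    then have "rearrangement ?M f t \<le> growth_envelope_function ?M ?X ?N t"
      unfolding growth_envelope_function_def by (rule SUP_upper)
    moreover have "w powr (1 / P) = A * ?\<Psi> t"
      using s KR P(2) t by (simp add: w_def A_def s_def powr_divide powr_mult powr_powr powr_minus field_simps)
    ultimately show ?thesis using f(3)[OF ts] by simp
  qed

  \<comment> \<open>The additional index\<close>
  have in_exponents: "ennreal P \<in> envelope_exponents ?M ?X ?N ?\<Psi> \<epsilon>" for \<epsilon>
  proof -
    have "envelope_functional ?M ?\<Psi> \<epsilon> (ennreal P) f \<le> ennreal ((C / P) powr (1 / P)) * ?N f" if "f \<in> ?X" for f
      using C(1) P(2) upper[OF that] by (intro envelope_functional_le) auto
    then show ?thesis
      unfolding envelope_exponents_def using P(2) C(1)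
      by (auto intro!: exI[of _ "(C / P) powr (1 / P)"])
  qed
  have exponents_ge: "ennreal P \<le> v" if \<epsilon>: "0 < \<epsilon>" and v: "v \<in> envelope_exponents ?M ?X ?N ?\<Psi> \<epsilon>" for \<epsilon> v
  proof (rule ccontr)
    assume "\<not> ennreal P \<le> v"
    then have "v < ennreal P" by simp
    moreover have "0 < v" using v by (simp add: envelope_exponents_def)
    ultimately obtain V where V: "v = ennreal V" "0 < V" "V < P"
      by (cases v) (auto simp: ennreal_less_iff)
    obtain c where c: "0 < c" "\<And>f. f \<in> ?X \<Longrightarrow> envelope_functional ?M ?\<Psi> \<epsilon> (ennreal V) f \<le> ennreal c * ?N f"
      using v unfolding V(1) envelope_exponents_def by blast
    \<comment> \<open>The steps below have measures s k = (a / 2) / 2^k, so R s k = b / 2^k, the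
      form required by \<open>envelope_functional_ge\<close>.\<close>
    define b where "b = R * a / 2"
    define \<beta> where "\<beta> = min \<epsilon> b / 2"
    have b: "0 < b" and \<beta>: "0 < \<beta>" "\<beta> < b" "\<beta> < \<epsilon>"
      using KR a \<epsilon> by (auto simp: b_def \<beta>_def min_def)
    define \<kappa> where "\<kappa> = (b / 2) powr (V / P) / P"
    \<comment> \<open>Collects the factors independent of n in the V-th power of c times the
      quasi-norm of the staircase.\<close>
    define \<gamma> where "\<gamma> = (c * K * (a / 2) powr (1 / P)) powr V"
    have bound: "\<kappa> * (real (Suc n) * ln 2 + ln (\<beta> / b)) \<le> \<gamma> * real (Suc n) powr (V / P)"
      if n: "b / 2 ^ Suc n \<le> \<beta>" for n
    proof -
      \<comment> \<open>Weight and measure balance: each product is a / 2, so the quasi-norm grows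
        only like (n + 1) to the power 1 / P, which after the V-th power gives the exponent V / P <
        1.\<close>
      obtain f where f: "f \<in> borel_measurable ?M"
        "?N f = ennreal (K * (\<Sum>k\<le>n. 2 ^ k * (a / 2 / 2 ^ k)) powr (1 / P))"
        "\<And>k t. k \<le> n \<Longrightarrow> t < R * (a / 2 / 2 ^ k) \<Longrightarrow> ennreal ((2 ^ k) powr (1 / P)) \<le> rearrangement ?M f t"
      proof -
        have "a / 2 / 2 ^ k < a" for k :: nat
        proof -
          have "a / 2 / 2 ^ k \<le> a / 2 / 1"
            using a(2) by (intro divide_left_mono) auto
          also have "\<dots> < a" using a(2) by simp
          finally show ?thesis .
        qed
        then show ?thesis
          using stair[of n "\<lambda>k. 2 ^ k" "\<lambda>k. a / 2 / 2 ^ k"] a(2) that by auto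
      qed
      have Nf: "?N f = ennreal (K * (real (Suc n) * (a / 2)) powr (1 / P))"
        using f(2) by simp
      then have fX: "f \<in> ?X" using f(1) by (simp add: mixed_Lp_def)
      have "ennreal (\<kappa> * (real (Suc n) * ln 2 + ln (\<beta> / b)))
          \<le> enn_powr (envelope_functional ?M ?\<Psi> \<epsilon> (ennreal V) f) V"
        unfolding \<kappa>_def using P(2) V(2) b n \<beta>
        by (intro envelope_functional_ge f(3)) (auto simp: b_def)
      also have "\<dots> \<le> enn_powr (ennreal c * ?N f) V"
        using V(2) by (intro enn_powr_mono c(2) fX) auto
      also have "\<dots> = ennreal ((c * (K * (real (Suc n) * (a / 2)) powr (1 / P))) powr V)"
        unfolding Nf using c(1) KR by (subst ennreal_mult[symmetric]) (auto simp: enn_powr_ennreal)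
      also have "(c * (K * (real (Suc n) * (a / 2)) powr (1 / P))) powr V = \<gamma> * real (Suc n) powr (V / P)"
        using c(1) KR a(2) times_divide_eq_left[of 1 P V]
        by (simp add: \<gamma>_def powr_mult powr_powr
            del: of_nat_Suc times_divide_eq_right times_divide_eq_left)
      finally show ?thesis
        by (subst (asm) ennreal_le_iff) (simp_all add: \<gamma>_def)
    qed
    have "(\<lambda>n. b / 2 ^ Suc n) \<longlonglongrightarrow> 0" by real_asymp
    then have "\<forall>\<^sub>F n in sequentially. b / 2 ^ Suc n < \<beta>"
      using \<beta>(1) by (rule order_tendstoD(2))
    then have "\<forall>\<^sub>F n in sequentially. \<kappa> * (real (Suc n) * ln 2 + ln (\<beta> / b)) \<le> \<gamma> * real (Suc n) powr (V / P)"
      by eventually_elim (rule bound, simp)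
    then show False
      using b P(2) V by (intro no_sublinear_bound[of \<kappa> "V / P"]) (auto simp: \<kappa>_def)
  qed
  \<comment> \<open>The infimum is attained at P for every positive \<epsilon>, so the threshold 1
    chosen at the end is arbitrary.\<close>
  have index: "ennreal P = Inf (envelope_exponents ?M ?X ?N ?\<Psi> \<epsilon>)" if "0 < \<epsilon>" for \<epsilon>
    using in_exponents exponents_ge[OF that] by (intro antisym Inf_lower Inf_greatest) auto

  \<comment> \<open>Regularity of the power function near 0\<close>
  have "continuous_on {0<..<1} (deriv ?\<Psi>) \<longleftrightarrow>
      continuous_on {0<..<1} (\<lambda>t. - (t powr (- 1 / P - 1) / P))"
    by (intro continuous_on_cong refl deriv_powr_neg) auto
  moreover have "continuous_on {0<..<1} (\<lambda>t. - (t powr (- 1 / P - 1) / P))"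
    using P(2) by (intro continuous_intros) auto
  ultimately have cont: "continuous_on {0<..<1} (deriv ?\<Psi>)" by blast
  have diff: "?\<Psi> differentiable (at t)" if "0 < t" for t
    using has_real_derivative_powr_neg[OF that] unfolding real_differentiable_def by blast
  have mono: "antimono_on {0<..<1} ?\<Psi>"
    using P(2) unfolding monotone_on_def by (auto intro!: powr_mono2')

  show ?thesis
    unfolding P_def[symmetric] unfolding P(1) has_growth_envelope_def prod.case
  proof (intro conjI)
    show "0 < ennreal P" using P(2) by simp
    show "\<exists>\<delta>>0. (\<forall>t\<in>{0<..<\<delta>}. 0 < ?\<Psi> t) \<and> antimono_on {0<..<\<delta>} ?\<Psi> \<and>
        (\<forall>t\<in>{0<..<\<delta>}. ?\<Psi> differentiable (at t)) \<and> continuous_on {0<..<\<delta>} (deriv ?\<Psi>)"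
      using cont diff mono by (intro exI[of _ 1]) auto
    have "0 < A" "0 < C powr (1 / P)" "0 < R * a / 2"
      using KR C(1) a(2) by (auto simp: A_def)
    then show "\<exists>\<epsilon>>0. \<exists>A>0. \<exists>B>0. \<forall>t\<in>{0<..<\<epsilon>}.
        ennreal (A * ?\<Psi> t) \<le> growth_envelope_function ?M ?X ?N t \<and>
        growth_envelope_function ?M ?X ?N t \<le> ennreal (B * ?\<Psi> t)"
      using growth_ge growth_le by (metis greaterThanLessThan_iff)
    show "\<exists>\<epsilon>\<^sub>0>0. \<forall>\<epsilon>\<in>{0<..<\<epsilon>\<^sub>0}. ennreal P = Inf (envelope_exponents ?M ?X ?N ?\<Psi> \<epsilon>)"
      using index by (intro exI[of _ 1]) auto
  qed
qed

end
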